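(* Let $d\ge 1$, let $\omega$ be a weight function and let $\varphi\in\mathcal{S}_\omega(\mathbb{R}^d)\setminus\{0\}$. Then the analysis operator $$C_\varphi:\ \mathcal{S}_\omega(\mathbb{R}^d)\longrightarrow\tilde\Lambda_\omega,\qquad C_\varphi f=(\langle f,\Pi(\sigma)\varphi\rangle)_{\sigma\in\Lambda},$$ is (well defined and) continuous.
   Context: A weight function is a continuous increasing function $\omega:[0,+\infty)\to[0,+\infty)$ such that: $(\alpha)$ there is $L\ge 1$ with $\omega(2t)\le L(\omega(t)+1)$ for all $t\ge 0$; $(\beta)$ $\omega(t)=o(t)$ as $t\to+\infty$; $(\gamma)$ there are $a\in\mathbb{R}$, $b>0$ with $\omega(t)\ge a+b\log(1+t)$ for all $t\ge 0$; $(\delta)$ the map $t\mapsto\omega(e^t)$ is convex. For a vector $\zeta$ one writes $\omega(\zeta):=\omega(|\zeta|)$, with $|\cdot|$ the Euclidean norm. The Fourier transform is $\hat u(\xi)=\int_{\mathbb{R}^d}u(x)e^{-i\langle x,\xi\rangle}dx$. The space $\mathcal{S}_\omega(\mathbb{R}^d)$ is the set of all $u\in L^1(\mathbb{R}^d)$ such that $u,\hat u\in C^\infty(\mathbb{R}^d)$ and, for each $\lambda>0$ and each $\alpha\in\mathbb{N}_0^d$, $\sup_{x}e^{\lambda\omega(x)}|\partial^\alpha u(x)|<+\infty$ and $\sup_{\xi}e^{\lambda\omega(\xi)}|\partial^\alpha\hat u(\xi)|<+\infty$. It carries the Fréchet topology given by these seminorms. For $z=(x,\xi)\in\mathbb{R}^{2d}$,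 $\Pi(z)f(y)=e^{i\langle y,\xi\rangle}f(y-x)$. The bracket is $\langle f,g\rangle=\int_{\mathbb{R}^d}f\overline{g}$. Throughout, $\Lambda=\alpha_0\mathbb{Z}^d\times\beta_0\mathbb{Z}^d$, where $\alpha_0,\beta_0>0$ are fixed so that $\{\Pi(\sigma)\varphi_0\}_{\sigma\in\Lambda}$ is a Gabor frame for $L^2(\mathbb{R}^d)$, with $\varphi_0(x)=e^{-|x|^2}$. $\tilde\Lambda_\omega$ is the Fréchet space of all complex families $c=(c_\sigma)_{\sigma\in\Lambda}$ such that $\|c\|_k:=\sup_{\sigma\in\Lambda}|c_\sigma|e^{k\omega(\sigma)}<+\infty$ for all $k\in\mathbb{N}$, with the topology given by the norms $\|\cdot\|_k$. *)

theory Defs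
  imports "HOL-Analysis.Analysis" "HOL-Library.Landau_Symbols"
begin

section \<open>Weight functions\<close>

text \<open>Only the values on \<open>[0, \<infinity>)\<close> are relevant; \<open>increasing\<close> is understood in the
  non-strict sense.\<close>

definition weight_function :: "(real \<Rightarrow> real) \<Rightarrow> bool" where
  "weight_function \<omega> \<longleftrightarrow>
     continuous_on {0..} \<omega> \<and> mono_on {0..} \<omega> \<and> (\<forall>t\<ge>0. 0 \<le> \<omega> t) \<and>
     (\<exists>L\<ge>1. \<forall>t\<ge>0. \<omega> (2 * t) \<le> L * (\<omega> t + 1)) \<and>
     \<omega> \<in> o[at_top](\<lambda>t. t) \<and>
     (\<exists>a b. b > 0 \<and> (\<forall>t\<ge>0. a + b * ln (1 + t) \<le> \<omega> t)) \<and>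
     convex_on UNIV (\<lambda>t. \<omega> (exp t))"

section \<open>Partial derivatives and smooth functions\<close>

definition partial :: "'d::finite \<Rightarrow> (real^'d \<Rightarrow> complex) \<Rightarrow> real^'d \<Rightarrow> complex" where
  "partial i f x = vector_derivative (\<lambda>t. f (x + t *\<^sub>R axis i 1)) (at 0)"

definition iter_partial :: "'d::finite list \<Rightarrow> (real^'d \<Rightarrow> complex) \<Rightarrow> real^'d \<Rightarrow> complex" where
  "iter_partial is f = foldr partial is f"

text \<open>Being \<open>C\<^sup>\<infinity>\<close>: the iterated partial derivatives of all orders exist and are continuous.\<close>

definition smooth :: "(real^'d::finite \<Rightarrow> complex) \<Rightarrow> bool" where
  "smooth f \<longleftrightarrow>
     (\<forall>is. continuous_on UNIV (iter_partial is f) \<and>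
       (\<forall>i x. (\<lambda>t. iter_partial is f (x + t *\<^sub>R axis i 1)) differentiable (at (0::real))))"

text \<open>The derivative of multi-index \<open>\<alpha>\<close>: differentiate \<open>\<alpha> i\<close> times in each coordinate
  direction \<open>i\<close>. The index type carries no order, so some order of differentiation is chosen;
  for smooth functions the result does not depend on it, by Schwarz's theorem.\<close>

definition multi_partial :: "('d::finite \<Rightarrow> nat) \<Rightarrow> (real^'d \<Rightarrow> complex) \<Rightarrow> real^'d \<Rightarrow> complex"
  where "multi_partial \<alpha> f = iter_partial (SOME is. \<forall>i. count_list is i = \<alpha> i) f"

section \<open>Topologies given by seminorms\<close>

text \<open>The topology on the function space \<open>V\<close> given by a family \<open>P\<close> of seminorms; the
  semiballs of all centres and radii form a subbase.\<close>

definition seminorm_topology ::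
    "('a \<Rightarrow> complex) set \<Rightarrow> (('a \<Rightarrow> complex) \<Rightarrow> real) set \<Rightarrow> ('a \<Rightarrow> complex) topology" where
  "seminorm_topology V P =
     topology_generated_by
       {{g \<in> V. p (\<lambda>x. g x - f x) < \<epsilon>} | f p \<epsilon>. f \<in> V \<and> p \<in> P \<and> 0 < \<epsilon>}"

lemma topspace_seminorm_topology:
  assumes "p \<in> P"
  shows "topspace (seminorm_topology V P) = V"
proof
  show "topspace (seminorm_topology V P) \<subseteq> V"
    unfolding seminorm_topology_def topology_generated_by_topspace by (rule Union_least) auto
next
  show "V \<subseteq> topspace (seminorm_topology V P)"
  proof
    fix f assume f: "f \<in> V"
    define e where "e = \<bar>p (\<lambda>x. 0)\<bar> + 1"
    have e: "0 < e" "p (\<lambda>x. 0) < e"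
      unfolding e_def by linarith+
    have "f \<in> {g \<in> V. p (\<lambda>x. g x - f x) < e}"
      using f e(2) by simp
    moreover have "{g \<in> V. p (\<lambda>x. g x - f x) < e}
        \<in> {{g \<in> V. p (\<lambda>x. g x - f x) < \<epsilon>} | f p \<epsilon>. f \<in> V \<and> p \<in> P \<and> 0 < \<epsilon>}"
      by (rule CollectI, rule exI[of _ f], rule exI[of _ p], rule exI[of _ e])
        (simp only: f assms e(1) simp_thms)
    ultimately show "f \<in> topspace (seminorm_topology V P)"
      unfolding seminorm_topology_def topology_generated_by_topspace by (rule UnionI[rotated])
  qed
qed

section \<open>The space \<open>\<S>\<^sub>\<omega>\<close>\<close>

definition fourier :: "(real^'d::finite \<Rightarrow> complex) \<Rightarrow> real^'d \<Rightarrow> complex" where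
  "fourier u \<xi> = (LINT x|lborel. u x * exp (- \<i> * of_real (x \<bullet> \<xi>)))"

definition weighted_deriv ::
    "(real \<Rightarrow> real) \<Rightarrow> real \<Rightarrow> ('d::finite \<Rightarrow> nat) \<Rightarrow> (real^'d \<Rightarrow> complex) \<Rightarrow> real^'d \<Rightarrow> real" where
  "weighted_deriv \<omega> r \<alpha> u x = exp (r * \<omega> (norm x)) * norm (multi_partial \<alpha> u x)"

definition S_space :: "(real \<Rightarrow> real) \<Rightarrow> (real^'d::finite \<Rightarrow> complex) set" where
  "S_space \<omega> = {u. integrable lborel u \<and> smooth u \<and> smooth (fourier u) \<and>
     (\<forall>r>0. \<forall>\<alpha>. bdd_above (range (weighted_deriv \<omega> r \<alpha> u)) \<and>
                bdd_above (range (weighted_deriv \<omega> r \<alpha> (fourier u))))}"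

definition S_seminorms :: "(real \<Rightarrow> real) \<Rightarrow> ((real^'d::finite \<Rightarrow> complex) \<Rightarrow> real) set" where
  "S_seminorms \<omega> =
     {(\<lambda>u. SUP x. weighted_deriv \<omega> r \<alpha> u x) | r \<alpha>. 0 < r} \<union>
     {(\<lambda>u. SUP \<xi>. weighted_deriv \<omega> r \<alpha> (fourier u) \<xi>) | r \<alpha>. 0 < r}"

definition S_topology :: "(real \<Rightarrow> real) \<Rightarrow> (real^'d::finite \<Rightarrow> complex) topology" where
  "S_topology \<omega> = seminorm_topology (S_space \<omega>) (S_seminorms \<omega>)"

lemma topspace_S_topology: "topspace (S_topology \<omega>) = S_space \<omega>"
proof -
  have "(\<lambda>u. SUP x. weighted_deriv \<omega> 1 (\<lambda>_. 0) u x) \<in> S_seminorms \<omega>"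
    unfolding S_seminorms_def
    by (rule UnI1, rule CollectI, rule exI[of _ 1], rule exI[of _ "\<lambda>_. 0"]) simp
  then show ?thesis
    unfolding S_topology_def by (rule topspace_seminorm_topology)
qed

section \<open>Time-frequency shifts and Gabor frames\<close>

definition tf_shift ::
    "(real^'d::finite) \<times> (real^'d) \<Rightarrow> (real^'d \<Rightarrow> complex) \<Rightarrow> real^'d \<Rightarrow> complex" where
  "tf_shift z f y = exp (\<i> * of_real (y \<bullet> snd z)) * f (y - fst z)"

definition bracket :: "(real^'d::finite \<Rightarrow> complex) \<Rightarrow> (real^'d \<Rightarrow> complex) \<Rightarrow> complex" where
  "bracket f g = (LINT y|lborel. f y * cnj (g y))"

definition lattice :: "real \<Rightarrow> real \<Rightarrow> ((real^'d::finite) \<times> (real^'d)) set" where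
  "lattice a b = {x. \<forall>i. \<exists>m::int. x $ i = a * of_int m} \<times> {\<xi>. \<forall>i. \<exists>n::int. \<xi> $ i = b * of_int n}"

definition square_integrable :: "(real^'d::finite \<Rightarrow> complex) \<Rightarrow> bool" where
  "square_integrable f \<longleftrightarrow> f \<in> borel_measurable lborel \<and> integrable lborel (\<lambda>x. (norm (f x))\<^sup>2)"

definition gabor_frame ::
    "(real^'d::finite \<Rightarrow> complex) \<Rightarrow> ((real^'d) \<times> (real^'d)) set \<Rightarrow> bool" where
  "gabor_frame g \<Gamma> \<longleftrightarrow>
     square_integrable g \<and>
     (\<exists>A B. 0 < A \<and> 0 < B \<and>
       (\<forall>f. square_integrable f \<longrightarrow>
         (\<lambda>\<sigma>. (norm (bracket f (tf_shift \<sigma> g)))\<^sup>2) summable_on \<Gamma> \<and>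
         A * (LINT x|lborel. (norm (f x))\<^sup>2) \<le> (\<Sum>\<^sub>\<infinity>\<sigma>\<in>\<Gamma>. (norm (bracket f (tf_shift \<sigma> g)))\<^sup>2) \<and>
         (\<Sum>\<^sub>\<infinity>\<sigma>\<in>\<Gamma>. (norm (bracket f (tf_shift \<sigma> g)))\<^sup>2) \<le> B * (LINT x|lborel. (norm (f x))\<^sup>2)))"

definition gaussian :: "real^'d::finite \<Rightarrow> complex" where
  "gaussian x = of_real (exp (- (norm x)\<^sup>2))"

section \<open>The sequence space and the analysis operator\<close>

text \<open>A family indexed by \<open>\<Gamma>\<close> is a function on the whole type that is zero off \<open>\<Gamma>\<close>, so
  that families form a vector space under the pointwise operations.\<close>

definition seq_space ::
    "(real \<Rightarrow> real) \<Rightarrow> 'a::real_normed_vector set \<Rightarrow> ('a \<Rightarrow> complex) set" where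
  "seq_space \<omega> \<Gamma> = {c. (\<forall>\<sigma>. \<sigma> \<notin> \<Gamma> \<longrightarrow> c \<sigma> = 0) \<and>
     (\<forall>k::nat. bdd_above ((\<lambda>\<sigma>. norm (c \<sigma>) * exp (real k * \<omega> (norm \<sigma>))) ` \<Gamma>))}"

definition seq_norm ::
    "(real \<Rightarrow> real) \<Rightarrow> 'a::real_normed_vector set \<Rightarrow> nat \<Rightarrow> ('a \<Rightarrow> complex) \<Rightarrow> real" where
  "seq_norm \<omega> \<Gamma> k c = (SUP \<sigma>\<in>\<Gamma>. norm (c \<sigma>) * exp (real k * \<omega> (norm \<sigma>)))"

definition seq_topology ::
    "(real \<Rightarrow> real) \<Rightarrow> 'a::real_normed_vector set \<Rightarrow> ('a \<Rightarrow> complex) topology" where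
  "seq_topology \<omega> \<Gamma> = seminorm_topology (seq_space \<omega> \<Gamma>) (range (seq_norm \<omega> \<Gamma>))"

lemma topspace_seq_topology: "topspace (seq_topology \<omega> \<Gamma>) = seq_space \<omega> \<Gamma>"
  unfolding seq_topology_def by (rule topspace_seminorm_topology[OF rangeI])

definition analysis_op ::
    "((real^'d::finite) \<times> (real^'d)) set \<Rightarrow> (real^'d \<Rightarrow> complex) \<Rightarrow> (real^'d \<Rightarrow> complex) \<Rightarrow>
     (real^'d) \<times> (real^'d) \<Rightarrow> complex" where
  "analysis_op \<Gamma> \<phi> f = (\<lambda>\<sigma>. if \<sigma> \<in> \<Gamma> then bracket f (tf_shift \<sigma> \<phi>) else 0)"

end

theory Submission
  imports Defs "HOL-Probability.Characteristic_Functions" "HOL-Probability.Sinc_Integral"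
begin

text \<open>The coefficient \<open>\<langle>f, \<Pi>(x, \<xi>)\<phi>\<rangle>\<close> is a short-time Fourier transform, and it must be shown to decay
  like \<open>exp (- k * \<omega> (norm (x, \<xi>)))\<close> for every \<open>k\<close>, with a constant given by a seminorm of \<open>f\<close>.

  For the decay in \<open>x\<close>, its modulus is at most the integral of \<open>\<bar>f y\<bar> * \<bar>\<phi> (y - x)\<bar>\<close>. Both factors decay
  faster than \<open>exp (- r * \<omega>)\<close> for every \<open>r\<close>, and by the doubling condition \<open>\<omega> (norm x)\<close> is at most
  \<open>L * (\<omega> (norm y) + \<omega> (norm (y - x)) + 1)\<close>. Hence part of the decay can be converted into decay in \<open>x\<close>,
  and the rest makes the integral converge since \<open>\<omega>\<close> dominates a logarithm
  (\<open>exp_decay_correlation\<close>).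

  For the decay in \<open>\<xi>\<close>, Parseval's formula replaces \<open>f\<close> and \<open>\<phi>\<close> by their Fourier transforms, and the
  modulation by \<open>\<xi>\<close> by a translation, so the same estimate applies to the transforms. Parseval's formula
  is derived from Fourier inversion in several variables, which is proved by Gaussian regularisation
  (\<open>fourier_inversion\<close>, \<open>parseval\<close>).

  Since the weight at \<open>(x, \<xi>)\<close> is controlled by the larger of the weights at \<open>x\<close> and \<open>\<xi>\<close>, one of the two
  bounds always suffices (\<open>short_time_fourier_decay\<close>). Thus each norm of the coefficient family is
  bounded by a constant times the sum of two seminorms of \<open>f\<close>, both of order zero, and by linearity
  this gives continuity (\<open>continuous_map_seminorm_topology\<close>).\<close>

section \<open>Lebesgue integration on Euclidean spaces\<close>

lemma lborel_integral_affine: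
  fixes f :: "'a::euclidean_space \<Rightarrow> 'b::{banach, second_countable_topology}"
  assumes f: "integrable lborel f" and c: "c \<noteq> 0"
  shows "(LINT x|lborel. f x) = \<bar>c\<bar> ^ DIM('a) *\<^sub>R (LINT x|lborel. f (t + c *\<^sub>R x))"
proof -
  have [measurable]: "f \<in> borel_measurable borel"
    using borel_measurable_integrable[OF f] by simp
  show ?thesis
    by (subst lborel_affine[OF c, of t]) (simp add: integral_density integral_distr)
qed

lemma lborel_integrable_affine:
  fixes f :: "'a::euclidean_space \<Rightarrow> 'b::{banach, second_countable_topology}"
  assumes f: "integrable lborel f" and c: "c \<noteq> 0"
  shows "integrable lborel (\<lambda>x. f (t + c *\<^sub>R x))"
proof -
  have [measurable]: "f \<in> borel_measurable borel"
    using borel_measurable_integrable[OF f] by simp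
  have "integrable (density (distr lborel borel (\<lambda>x. t + c *\<^sub>R x)) (\<lambda>_. ennreal (\<bar>c\<bar> ^ DIM('a)))) f"
    using f lborel_affine[OF c, of t] by (simp add: ennreal_power)
  then have "integrable lborel (\<lambda>x. \<bar>c\<bar> ^ DIM('a) *\<^sub>R f (t + c *\<^sub>R x))"
    by (simp add: integrable_density integrable_distr_eq)
  from integrable_scaleR_right[of "inverse (\<bar>c\<bar> ^ DIM('a))", OF this] show ?thesis
    using c by simp
qed

text \<open>The Lebesgue measure of a Euclidean space is the image of a product of one-dimensional Lebesgue
  measures, so an integral of a product of functions of single coordinates splits. This reduces the
  Fourier transform of the Gaussian, and the integrability of \<open>cauchy_kernel\<close>, to dimension one.\<close>

lemma
  fixes f :: "'a::euclidean_space \<Rightarrow> real \<Rightarrow> 'b::{real_normed_field, banach, second_countable_topology}"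
  assumes f: "\<And>b. b \<in> Basis \<Longrightarrow> integrable lborel (f b)"
  shows integrable_lborel_prod: "integrable lborel (\<lambda>x. \<Prod>b\<in>Basis. f b (x \<bullet> b))"
    and integral_lborel_prod: "(LINT x|lborel. (\<Prod>b\<in>Basis. f b (x \<bullet> b))) =
      (\<Prod>b\<in>Basis. LINT t|lborel. f b t)"
proof -
  interpret product_sigma_finite "\<lambda>_::'a. lborel :: real measure"
    by standard
  have [measurable]: "f b \<in> borel_measurable borel" if "b \<in> Basis" for b
    using borel_measurable_integrable[OF f[OF that]] by simp
  let ?T = "\<lambda>x. \<Sum>b\<in>Basis. x b *\<^sub>R b :: 'a"
  have T: "?T \<in> measurable (\<Pi>\<^sub>M b\<in>Basis. lborel) borel"
    by measurable
  have m: "(\<lambda>x. \<Prod>b\<in>Basis. f b (x \<bullet> b)) \<in> borel_measurable (borel :: 'a measure)"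
    by measurable
  have eq: "(\<Prod>b\<in>Basis. f b (?T x \<bullet> b)) = (\<Prod>b\<in>Basis. f b (x b))" for x
    by (intro prod.cong) (simp_all add: inner_sum_left inner_Basis if_distrib cong: if_cong)
  show "integrable lborel (\<lambda>x. \<Prod>b\<in>Basis. f b (x \<bullet> b))"
    unfolding lborel_eq[where 'a='a] integrable_distr_eq[OF T m] eq
    by (rule product_integrable_prod[OF finite_Basis f])
  show "(LINT x|lborel. (\<Prod>b\<in>Basis. f b (x \<bullet> b))) = (\<Prod>b\<in>Basis. LINT t|lborel. f b t)"
    unfolding lborel_eq[where 'a='a] integral_distr[OF T m] eq
    by (rule product_integral_prod[OF finite_Basis f])
qed

text \<open>The bounded factor will be a character, a Gaussian or a function in \<open>\<S>\<^sub>\<omega>\<close>.\<close>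

lemma integrable_mult_bounded:
  fixes f g :: "'a::euclidean_space \<Rightarrow> 'b::{real_normed_field, banach, second_countable_topology}"
  assumes f: "integrable lborel f" and g: "g \<in> borel_measurable borel"
    and bound: "\<And>x. norm (g x) \<le> B"
  shows "integrable lborel (\<lambda>x. f x * g x)"
proof (rule Bochner_Integration.integrable_bound[of _ "\<lambda>x. B * norm (f x)"])
  show "integrable lborel (\<lambda>x. B * norm (f x))"
    using f by simp
  have [measurable]: "f \<in> borel_measurable borel"
    using borel_measurable_integrable[OF f] by simp
  show "(\<lambda>x. f x * g x) \<in> borel_measurable lborel"
    using g by simp
  have "norm (f x * g x) \<le> B * norm (f x)" for x
    using mult_left_mono[OF bound[of x], of "norm (f x)"]
    by (simp add: norm_mult mult.commute)
  then show "AE x in lborel. norm (f x * g x) \<le> norm (B * norm (f x))"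
    by (intro always_eventually allI) (metis abs_ge_self order_trans real_norm_def)
qed

text \<open>The integrand is dominated by the tensor product of \<open>\<bar>f\<bar>\<close> and \<open>\<bar>g\<bar>\<close>, which is integrable. The kernel
  \<open>k\<close> will be a character.\<close>

lemma fubini_product_kernel:
  fixes f g :: "'a::euclidean_space \<Rightarrow> complex"
    and k :: "'a \<Rightarrow> 'a \<Rightarrow> complex"
  assumes f: "integrable lborel f" and g: "integrable lborel g"
    and k: "continuous_on UNIV (\<lambda>(x, y). k x y)" and k1: "\<And>x y. norm (k x y) \<le> 1"
  shows "(LINT y|lborel. LINT x|lborel. f x * g y * k x y) =
    (LINT x|lborel. LINT y|lborel. f x * g y * k x y)"
proof -
  have [measurable]: "f \<in> borel_measurable borel" "g \<in> borel_measurable borel"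
    using borel_measurable_integrable[OF f] borel_measurable_integrable[OF g] by simp_all
  have "(\<lambda>(x, y). k x y) \<in> borel_measurable borel"
    using k by (rule borel_measurable_continuous_onI)
  then have [measurable]: "(\<lambda>(x, y). k x y) \<in> borel_measurable (borel \<Otimes>\<^sub>M borel)"
    by (simp add: borel_prod)
  have kx: "k x \<in> borel_measurable borel" for x
    by (rule borel_measurable_continuous_onI)
       (rule continuous_on_compose2[OF k, of UNIV "Pair x", simplified], intro continuous_intros)
  have "integrable (lborel \<Otimes>\<^sub>M lborel) (\<lambda>(x, y). f x * g y * k x y)"
  proof (rule lborel_pair.Fubini_integrable)
    show "(\<lambda>(x, y). f x * g y * k x y) \<in> borel_measurable (lborel \<Otimes>\<^sub>M lborel)"
    proof -
      have "(\<lambda>p. f (fst p) * g (snd p) * (\<lambda>(x, y). k x y) p) \<in> borel_measurable (lborel \<Otimes>\<^sub>M lborel)"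
        by measurable
      then show ?thesis by (simp add: case_prod_beta')
    qed
    have gk: "integrable lborel (\<lambda>y. g y * k x y)" for x
      by (rule integrable_mult_bounded[OF g kx k1])
    show "AE x in lborel. integrable lborel (\<lambda>y. case (x, y) of (x, y) \<Rightarrow> f x * g y * k x y)"
      using gk by (simp add: mult.assoc)
    show "integrable lborel (\<lambda>x. LINT y|lborel. norm (case (x, y) of (x, y) \<Rightarrow> f x * g y * k x y))"
    proof (rule Bochner_Integration.integrable_bound)
      show "integrable lborel (\<lambda>x. norm (f x) * (LINT y|lborel. norm (g y)))"
        using f by simp
      show "(\<lambda>x. LINT y|lborel. norm (case (x, y) of (x, y) \<Rightarrow> f x * g y * k x y)) \<in> borel_measurable lborel"
      proof -
        have "(\<lambda>p. norm (f (fst p) * g (snd p) * (\<lambda>(x, y). k x y) p)) \<in> borel_measurable (lborel \<Otimes>\<^sub>M lborel)"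
          by measurable
        then have "(\<lambda>(x, y). norm (f x * g y * k x y)) \<in> borel_measurable (lborel \<Otimes>\<^sub>M lborel)"
          by (simp add: case_prod_beta')
        then have "(\<lambda>x. LINT y|lborel. norm (f x * g y * k x y)) \<in> borel_measurable lborel"
          by (rule lborel.borel_measurable_lebesgue_integral)
        then show ?thesis by simp
      qed
      have "(LINT y|lborel. norm (f x * g y * k x y)) \<le> norm (f x) * (LINT y|lborel. norm (g y))" for x
      proof -
        have "(LINT y|lborel. norm (g y * k x y)) \<le> (LINT y|lborel. norm (g y))"
          using k1[of x]
          by (intro integral_mono integrable_norm gk g) (auto simp: norm_mult intro: mult_left_le)
        then show ?thesis
          by (simp add: norm_mult mult.assoc mult_left_mono)
      qed
      then show "AE x in lborel. norm (LINT y|lborel. norm (case (x, y) of (x, y) \<Rightarrow> f x * g y * k x y))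
          \<le> norm (norm (f x) * (LINT y|lborel. norm (g y)))"
        by (intro always_eventually allI) (simp add: abs_mult)
    qed
  qed
  then show ?thesis by (rule lborel_pair.Fubini_integral)
qed

section \<open>Gaussians and their Fourier transforms\<close>

text \<open>This normalisation, unlike \<open>exp (- (norm x)\<^sup>2)\<close>, makes the function an eigenfunction of the Fourier
  transform and a multiple of the standard normal density.\<close>

definition gauss :: "'a::euclidean_space \<Rightarrow> real" where
  "gauss x = exp (- (norm x)\<^sup>2 / 2)"

lemma gauss_prod: "gauss x = (\<Prod>b\<in>Basis. exp (- (x \<bullet> b)\<^sup>2 / 2))"
  by (simp add: gauss_def exp_sum[symmetric] sum_negf sum_divide_distrib[symmetric]
      dot_square_norm[symmetric] euclidean_inner[of x x] power2_eq_square[symmetric])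

lemma gauss_pos: "0 < gauss x" and gauss_le_1: "gauss x \<le> 1"
  by (simp_all add: gauss_def)

lemma gauss_0: "gauss 0 = 1"
  by (simp add: gauss_def)

lemma continuous_gauss: "continuous_on UNIV gauss"
  unfolding gauss_def by (intro continuous_intros) auto

text \<open>This is the characteristic function of the standard normal distribution, freed of the
  normalising factor of its density.\<close>

lemma
  shows integrable_gauss_character_real:
      "integrable lborel (\<lambda>t::real. complex_of_real (exp (- t\<^sup>2 / 2)) * exp (\<i> * of_real (t * v)))"
    and integral_gauss_character_real:
      "(LINT t|lborel. complex_of_real (exp (- t\<^sup>2 / 2)) * exp (\<i> * of_real (t * v))) =
        of_real (sqrt (2 * pi) * exp (- v\<^sup>2 / 2))"
proof -
  have ch: "char std_normal_distribution v = (LINT t|lborel. std_normal_density t *\<^sub>R exp (\<i> * of_real (v * t)))"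
    unfolding char_def by (subst integral_density) (auto simp: comp_def)
  have eq: "complex_of_real (exp (- t\<^sup>2 / 2)) * exp (\<i> * of_real (t * v)) =
      of_real (sqrt (2 * pi)) * (std_normal_density t *\<^sub>R exp (\<i> * of_real (v * t)))" for t
    by (simp add: std_normal_density_def scaleR_conv_of_real mult.commute)
  have "integrable lborel (\<lambda>t. of_real (std_normal_density t) * exp (\<i> * of_real (v * t)))"
    by (rule integrable_mult_bounded[where B=1])
       (auto intro!: borel_measurable_continuous_onI continuous_intros)
  then show "integrable lborel (\<lambda>t::real. complex_of_real (exp (- t\<^sup>2 / 2)) * exp (\<i> * of_real (t * v)))"
    unfolding eq by (simp add: scaleR_conv_of_real)
  show "(LINT t|lborel. complex_of_real (exp (- t\<^sup>2 / 2)) * exp (\<i> * of_real (t * v))) =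
        of_real (sqrt (2 * pi) * exp (- v\<^sup>2 / 2))"
    unfolding eq integral_mult_right_zero ch[symmetric] char_std_normal_distribution
    by simp
qed

lemma
  fixes v :: "'a::euclidean_space"
  shows integrable_gauss_character:
      "integrable lborel (\<lambda>x. complex_of_real (gauss x) * exp (\<i> * of_real (x \<bullet> v)))"
    and integral_gauss_character:
      "(LINT x|lborel. complex_of_real (gauss x) * exp (\<i> * of_real (x \<bullet> v))) =
        of_real (sqrt (2 * pi) ^ DIM('a) * gauss v)"
proof -
  let ?f = "\<lambda>b t. complex_of_real (exp (- t\<^sup>2 / 2)) * exp (\<i> * of_real (t * (v \<bullet> b)))"
  have eq: "complex_of_real (gauss x) * exp (\<i> * of_real (x \<bullet> v)) = (\<Prod>b\<in>Basis. ?f b (x \<bullet> b))" for x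
  proof -
    have "exp (\<i> * of_real (x \<bullet> v)) = (\<Prod>b\<in>Basis. exp (\<i> * of_real ((x \<bullet> b) * (v \<bullet> b))))"
      by (simp add: exp_sum[symmetric] sum_distrib_left[symmetric] euclidean_inner[of x v])
    then show ?thesis
      by (simp add: gauss_prod prod.distrib)
  qed
  show "integrable lborel (\<lambda>x. complex_of_real (gauss x) * exp (\<i> * of_real (x \<bullet> v)))"
    unfolding eq by (intro integrable_lborel_prod integrable_gauss_character_real)
  have "(LINT x|lborel. complex_of_real (gauss x) * exp (\<i> * of_real (x \<bullet> v))) =
      (\<Prod>b\<in>(Basis::'a set). complex_of_real (sqrt (2 * pi) * exp (- (v \<bullet> b)\<^sup>2 / 2)))"
    unfolding eq
    by (subst integral_lborel_prod[OF integrable_gauss_character_real])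
       (simp only: integral_gauss_character_real)
  also have "\<dots> = of_real (sqrt (2 * pi) ^ DIM('a) * gauss v)"
    by (simp add: gauss_prod prod.distrib)
  finally show "(LINT x|lborel. complex_of_real (gauss x) * exp (\<i> * of_real (x \<bullet> v))) =
        of_real (sqrt (2 * pi) ^ DIM('a) * gauss v)" .
qed

lemma integrable_gauss: "integrable lborel (gauss :: 'a::euclidean_space \<Rightarrow> real)"
  and integral_gauss: "(LINT x|lborel. gauss (x::'a)) = sqrt (2 * pi) ^ DIM('a)"
proof -
  show "integrable lborel (gauss :: 'a \<Rightarrow> real)"
    using integrable_gauss_character[of "0::'a"] integrable_Re by fastforce
  show "(LINT x|lborel. gauss (x::'a)) = sqrt (2 * pi) ^ DIM('a)"
    using integral_gauss_character[of "0::'a"] by (simp add: gauss_0 flip: of_real_power of_real_mult)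
qed

section \<open>Fourier inversion and Parseval's formula\<close>

lemma continuous_character:
  "continuous_on UNIV (\<lambda>(x::'a::real_inner, y). exp (\<i> * complex_of_real (x \<bullet> y)))"
  "continuous_on UNIV (\<lambda>(x::'a::real_inner, y). exp (- \<i> * complex_of_real (x \<bullet> y)))"
  unfolding case_prod_beta' by (intro continuous_intros)+

lemma norm_character:
  "norm (exp (\<i> * complex_of_real t)) = 1" "norm (exp (- \<i> * complex_of_real t)) = 1"
  by (simp_all add: norm_exp_eq_Re)

lemma integrable_mult_continuous:
  fixes f g :: "'a::euclidean_space \<Rightarrow> complex"
  assumes "integrable lborel f" "continuous_on UNIV g" "\<And>x. norm (g x) \<le> B"
  shows "integrable lborel (\<lambda>x. f x * g x)"
  using assms by (intro integrable_mult_bounded borel_measurable_continuous_onI)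

text \<open>Dilating the Gaussian by \<open>e\<close> dilates its Fourier transform by \<open>1 / e\<close>: as \<open>e\<close> tends to 0 the
  Gaussian tends to the constant 1 and its transform concentrates at the origin.\<close>

lemma integral_affine_gauss_character:
  fixes v :: "'a::euclidean_space"
  assumes e: "e > 0"
  shows "(LINT x|lborel. complex_of_real (gauss (e *\<^sub>R x)) * exp (\<i> * of_real (x \<bullet> v))) =
    of_real (sqrt (2 * pi) ^ DIM('a) * (1 / e) ^ DIM('a) * gauss ((1 / e) *\<^sub>R v))"
proof -
  have "(LINT x|lborel. complex_of_real (gauss x) * exp (\<i> * of_real (x \<bullet> ((1 / e) *\<^sub>R v)))) =
      e ^ DIM('a) *\<^sub>R (LINT x|lborel. complex_of_real (gauss (e *\<^sub>R x)) * exp (\<i> * of_real (x \<bullet> v)))"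
    using e lborel_integral_affine[OF integrable_gauss_character[of "(1 / e) *\<^sub>R v"], of e 0] by simp
  then have "of_real (sqrt (2 * pi) ^ DIM('a) * gauss ((1 / e) *\<^sub>R v)) =
      e ^ DIM('a) *\<^sub>R (LINT x|lborel. complex_of_real (gauss (e *\<^sub>R x)) * exp (\<i> * of_real (x \<bullet> v)))"
    unfolding integral_gauss_character .
  then show ?thesis
    using e by (simp add: field_simps scaleR_conv_of_real)
qed

text \<open>Damping the inversion integral by a wide Gaussian makes the double integral absolutely convergent,
  so the order of integration may be exchanged. The inner integral is then the transform of a
  Gaussian, a narrow bump around \<open>y\<close>, and the substitution \<open>u = y - e *\<^sub>R v\<close> turns the result into an
  average of \<open>f\<close> near \<open>y\<close>.\<close>

lemma fourier_gauss_mean: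
  fixes f :: "real^'d::finite \<Rightarrow> complex"
  assumes f: "integrable lborel f" and cf: "continuous_on UNIV f"
    and bf: "\<And>x. norm (f x) \<le> B" and e: "e > 0"
  shows "(LINT \<eta>|lborel. fourier f \<eta> * exp (\<i> * of_real (y \<bullet> \<eta>)) * of_real (gauss (e *\<^sub>R \<eta>))) =
    of_real (sqrt (2 * pi) ^ CARD('d)) * (LINT v|lborel. f (y - e *\<^sub>R v) * of_real (gauss v))"
proof -
  define g where "g \<eta> = exp (\<i> * of_real (y \<bullet> \<eta>)) * complex_of_real (gauss (e *\<^sub>R \<eta>))" for \<eta>
  have ig: "integrable lborel g"
  proof -
    have "integrable lborel (\<lambda>\<eta>::real^'d. complex_of_real (gauss (e *\<^sub>R \<eta>)))"
      using lborel_integrable_affine[OF integrable_gauss, of e "0::real^'d"] e by simp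
    then have "integrable lborel (\<lambda>\<eta>. complex_of_real (gauss (e *\<^sub>R \<eta>)) * exp (\<i> * of_real (y \<bullet> \<eta>)))"
      by (rule integrable_mult_continuous[where B=1]) (auto intro!: continuous_intros)
    then show ?thesis
      unfolding g_def by (simp add: mult.commute)
  qed
  have "(LINT \<eta>|lborel. fourier f \<eta> * exp (\<i> * of_real (y \<bullet> \<eta>)) * of_real (gauss (e *\<^sub>R \<eta>))) =
      (LINT \<eta>|lborel. LINT u|lborel. f u * g \<eta> * exp (- \<i> * of_real (u \<bullet> \<eta>)))"
  proof (intro Bochner_Integration.integral_cong refl)
    fix \<eta> :: "real^'d"
    have "fourier f \<eta> * g \<eta> = (LINT u|lborel. f u * exp (- \<i> * of_real (u \<bullet> \<eta>)) * g \<eta>)"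
      unfolding fourier_def by simp
    then show "fourier f \<eta> * exp (\<i> * of_real (y \<bullet> \<eta>)) * of_real (gauss (e *\<^sub>R \<eta>)) =
        (LINT u|lborel. f u * g \<eta> * exp (- \<i> * of_real (u \<bullet> \<eta>)))"
      by (simp add: g_def mult_ac)
  qed
  also have "\<dots> = (LINT u|lborel. LINT \<eta>|lborel. f u * g \<eta> * exp (- \<i> * of_real (u \<bullet> \<eta>)))"
    by (rule fubini_product_kernel[OF f ig continuous_character(2)]) (simp only: norm_character)
  also have "\<dots> = (LINT u|lborel. f u *
      of_real (sqrt (2 * pi) ^ CARD('d) * (1 / e) ^ CARD('d) * gauss ((1 / e) *\<^sub>R (y - u))))"
  proof (intro Bochner_Integration.integral_cong refl)
    fix u :: "real^'d"
    have "f u * g \<eta> * exp (- \<i> * of_real (u \<bullet> \<eta>)) =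
        f u * (of_real (gauss (e *\<^sub>R \<eta>)) * exp (\<i> * of_real (\<eta> \<bullet> (y - u))))" for \<eta>
    proof -
      have "exp (\<i> * of_real (y \<bullet> \<eta>)) * exp (- \<i> * of_real (u \<bullet> \<eta>)) = exp (\<i> * of_real (\<eta> \<bullet> (y - u)))"
        by (simp add: exp_add[symmetric] inner_diff_right inner_commute algebra_simps)
      then show ?thesis
        by (simp add: g_def mult_ac)
    qed
    then show "(LINT \<eta>|lborel. f u * g \<eta> * exp (- \<i> * of_real (u \<bullet> \<eta>))) = f u *
      of_real (sqrt (2 * pi) ^ CARD('d) * (1 / e) ^ CARD('d) * gauss ((1 / e) *\<^sub>R (y - u)))"
      by (simp only: integral_mult_right_zero integral_affine_gauss_character[OF e]) simp
  qed
  also have "\<dots> = of_real (sqrt (2 * pi) ^ CARD('d) * (1 / e) ^ CARD('d)) *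
      (LINT u|lborel. f u * of_real (gauss ((1 / e) *\<^sub>R (y - u))))"
    by (subst integral_mult_right_zero[symmetric]) (simp add: mult_ac)
  also have "(LINT u|lborel. f u * of_real (gauss ((1 / e) *\<^sub>R (y - u)))) =
      e ^ CARD('d) *\<^sub>R (LINT v|lborel. f (y - e *\<^sub>R v) * of_real (gauss v))"
  proof -
    have "integrable lborel (\<lambda>u. f u * complex_of_real (gauss ((1 / e) *\<^sub>R (y - u))))"
      by (rule integrable_mult_continuous[OF f, where B=1])
         (auto intro!: continuous_intros continuous_on_compose2[OF continuous_gauss]
            simp: gauss_le_1 less_imp_le[OF gauss_pos])
    from lborel_integral_affine[OF this, of "- e" y] show ?thesis
      using e by simp
  qed
  finally show ?thesis
    using e by (simp add: scaleR_conv_of_real field_simps)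
qed

text \<open>Let the Gaussian damping in the previous identity disappear. The left side converges by dominated
  convergence because the Fourier transform is integrable. The right side tends to \<open>f y\<close> times the
  integral of the Gaussian because \<open>f\<close> is continuous and bounded. That integral and the
  constant of the identity are both \<open>sqrt (2 * pi) ^ d\<close>, which gives the factor \<open>(2 * pi) ^ d\<close>.\<close>

theorem fourier_inversion:
  fixes f :: "real^'d::finite \<Rightarrow> complex"
  assumes f: "integrable lborel f" and cf: "continuous_on UNIV f" and bf: "\<And>x. norm (f x) \<le> B"
    and F: "integrable lborel (fourier f)"
  shows "f y = of_real (1 / (2 * pi) ^ CARD('d)) *
    (LINT \<eta>|lborel. fourier f \<eta> * exp (\<i> * of_real (y \<bullet> \<eta>)))"
proof -
  define e where "e n = inverse (real (Suc n))" for n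
  have e0: "e n > 0" for n
    by (simp add: e_def)
  have elim: "e \<longlonglongrightarrow> 0"
    unfolding e_def by (rule LIMSEQ_inverse_real_of_nat)
  let ?K = "complex_of_real (sqrt (2 * pi) ^ CARD('d))"
  have [measurable]: "fourier f \<in> borel_measurable borel" "f \<in> borel_measurable borel"
    "gauss \<in> borel_measurable (borel :: (real^'d) measure)"
    using borel_measurable_integrable[OF F] borel_measurable_integrable[OF f]
      borel_measurable_integrable[OF integrable_gauss] by simp_all
  have Fc: "integrable lborel (\<lambda>\<eta>. fourier f \<eta> * exp (\<i> * of_real (y \<bullet> \<eta>)))"
    by (rule integrable_mult_continuous[OF F, where B=1]) (auto intro!: continuous_intros)
  note [measurable] = borel_measurable_integrable[OF Fc, simplified]
  have "(\<lambda>n. LINT \<eta>|lborel. fourier f \<eta> * exp (\<i> * of_real (y \<bullet> \<eta>)) * of_real (gauss (e n *\<^sub>R \<eta>)))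
      \<longlonglongrightarrow> (LINT \<eta>|lborel. fourier f \<eta> * exp (\<i> * of_real (y \<bullet> \<eta>)))"
  proof (rule integral_dominated_convergence)
    show "integrable lborel (\<lambda>\<eta>. norm (fourier f \<eta>))"
      using F by simp
    show "AE \<eta> in lborel. norm (fourier f \<eta> * exp (\<i> * of_real (y \<bullet> \<eta>)) * of_real (gauss (e n *\<^sub>R \<eta>)))
        \<le> norm (fourier f \<eta>)" for n
      by (auto simp: norm_mult gauss_le_1 less_imp_le[OF gauss_pos] intro!: mult_left_le)
    show "AE \<eta> in lborel. (\<lambda>n. fourier f \<eta> * exp (\<i> * of_real (y \<bullet> \<eta>)) * of_real (gauss (e n *\<^sub>R \<eta>)))
        \<longlonglongrightarrow> fourier f \<eta> * exp (\<i> * of_real (y \<bullet> \<eta>))"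
    proof (intro always_eventually allI)
      fix \<eta> :: "real^'d"
      have "(\<lambda>n. gauss (e n *\<^sub>R \<eta>)) \<longlonglongrightarrow> gauss (0 *\<^sub>R \<eta>)"
        by (rule continuous_on_tendsto_compose[OF continuous_gauss])
           (auto intro!: tendsto_eq_intros elim)
      then have "(\<lambda>n. complex_of_real (gauss (e n *\<^sub>R \<eta>))) \<longlonglongrightarrow> 1"
        by (auto simp: gauss_0 dest: tendsto_of_real)
      from tendsto_mult_left[OF this, of "fourier f \<eta> * exp (\<i> * of_real (y \<bullet> \<eta>))"]
      show "(\<lambda>n. fourier f \<eta> * exp (\<i> * of_real (y \<bullet> \<eta>)) * of_real (gauss (e n *\<^sub>R \<eta>)))
        \<longlonglongrightarrow> fourier f \<eta> * exp (\<i> * of_real (y \<bullet> \<eta>))"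
        by simp
    qed
  qed measurable
  moreover have "(\<lambda>n. ?K * (LINT v|lborel. f (y - e n *\<^sub>R v) * of_real (gauss v)))
      \<longlonglongrightarrow> ?K * (LINT v|lborel. f y * of_real (gauss (v::real^'d)))"
  proof (rule tendsto_mult_left, rule integral_dominated_convergence)
    show "integrable lborel (\<lambda>v::real^'d. B * gauss v)"
      by (intro integrable_mult_right integrable_gauss)
    show "AE v in lborel. norm (f (y - e n *\<^sub>R v) * of_real (gauss v)) \<le> B * gauss v" for n
      using bf by (auto simp: norm_mult less_imp_le[OF gauss_pos] intro!: mult_right_mono)
    show "AE v in lborel. (\<lambda>n. f (y - e n *\<^sub>R v) * of_real (gauss v)) \<longlonglongrightarrow> f y * of_real (gauss v)"
    proof (intro always_eventually allI tendsto_mult_right)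
      fix v
      have "(\<lambda>n. f (y - e n *\<^sub>R v)) \<longlonglongrightarrow> f (y - 0 *\<^sub>R v)"
        by (rule continuous_on_tendsto_compose[OF cf]) (auto intro!: tendsto_eq_intros elim)
      then show "(\<lambda>n. f (y - e n *\<^sub>R v)) \<longlonglongrightarrow> f y" by simp
    qed
  qed measurable
  ultimately have "(LINT \<eta>|lborel. fourier f \<eta> * exp (\<i> * of_real (y \<bullet> \<eta>))) =
      ?K * (LINT v|lborel. f y * of_real (gauss (v::real^'d)))"
    unfolding fourier_gauss_mean[OF f cf bf e0] by (rule LIMSEQ_unique)
  also have "\<dots> = ?K * ?K * f y"
    by (simp add: integral_gauss)
  also have "?K * ?K = of_real ((2 * pi) ^ CARD('d))"
    unfolding of_real_mult[symmetric] power_mult_distrib[symmetric] by simp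
  finally show ?thesis
    by (simp add: field_simps)
qed

text \<open>Insert the inversion formula for \<open>f\<close> and exchange the integrals; the inner integral is then the
  conjugate of the Fourier transform of \<open>h\<close>. Only one of the two functions has to satisfy the
  inversion formula.\<close>

lemma parseval:
  fixes f h :: "real^'d::finite \<Rightarrow> complex"
  assumes f: "integrable lborel f" and cf: "continuous_on UNIV f" and bf: "\<And>x. norm (f x) \<le> B"
    and F: "integrable lborel (fourier f)" and h: "integrable lborel h"
  shows "bracket f h = of_real (1 / (2 * pi) ^ CARD('d)) * bracket (fourier f) (fourier h)"
proof -
  let ?c = "complex_of_real (1 / (2 * pi) ^ CARD('d))"
  have ch: "integrable lborel (\<lambda>x. cnj (h x))"
    using h by simp
  have "bracket f h = (LINT y|lborel. ?c *
      (LINT \<eta>|lborel. fourier f \<eta> * cnj (h y) * exp (\<i> * of_real (y \<bullet> \<eta>))))"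
    unfolding bracket_def
  proof (intro Bochner_Integration.integral_cong refl)
    fix y
    have "f y * cnj (h y) = ?c * ((LINT \<eta>|lborel. fourier f \<eta> * exp (\<i> * of_real (y \<bullet> \<eta>))) * cnj (h y))"
      by (subst fourier_inversion[OF f cf bf F]) simp
    also have "(LINT \<eta>|lborel. fourier f \<eta> * exp (\<i> * of_real (y \<bullet> \<eta>))) * cnj (h y) =
        (LINT \<eta>|lborel. fourier f \<eta> * exp (\<i> * of_real (y \<bullet> \<eta>)) * cnj (h y))"
      by simp
    finally show "f y * cnj (h y) = ?c *
        (LINT \<eta>|lborel. fourier f \<eta> * cnj (h y) * exp (\<i> * of_real (y \<bullet> \<eta>)))"
      by (simp add: mult_ac)
  qed
  also have "\<dots> = ?c * (LINT y|lborel. LINT \<eta>|lborel. fourier f \<eta> * cnj (h y) * exp (\<i> * of_real (\<eta> \<bullet> y)))"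
    by (simp add: inner_commute)
  also have "(LINT y|lborel. LINT \<eta>|lborel. fourier f \<eta> * cnj (h y) * exp (\<i> * of_real (\<eta> \<bullet> y))) =
      (LINT \<eta>|lborel. LINT y|lborel. fourier f \<eta> * cnj (h y) * exp (\<i> * of_real (\<eta> \<bullet> y)))"
    by (rule fubini_product_kernel[OF F ch continuous_character(1)]) simp
  also have "\<dots> = (LINT \<eta>|lborel. fourier f \<eta> * cnj (fourier h \<eta>))"
  proof (intro Bochner_Integration.integral_cong refl)
    fix \<eta> :: "real^'d"
    have "cnj (fourier h \<eta>) = (LINT y|lborel. cnj (h y * exp (- \<i> * of_real (y \<bullet> \<eta>))))"
      unfolding fourier_def by (rule Bochner_Integration.integral_cnj[symmetric])
    also have "\<dots> = (LINT y|lborel. cnj (h y) * exp (\<i> * of_real (\<eta> \<bullet> y)))"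
      by (simp add: exp_cnj inner_commute)
    finally show "(LINT y|lborel. fourier f \<eta> * cnj (h y) * exp (\<i> * of_real (\<eta> \<bullet> y))) =
        fourier f \<eta> * cnj (fourier h \<eta>)"
      by (simp add: mult.assoc)
  qed
  finally show ?thesis
    unfolding bracket_def .
qed

section \<open>Time-frequency shifts\<close>

lemma integrable_tf_shift:
  fixes h :: "real^'d::finite \<Rightarrow> complex"
  assumes h: "integrable lborel h"
  shows "integrable lborel (tf_shift (x, \<xi>) h)"
proof -
  have "integrable lborel (\<lambda>y. h (y - x))"
    using lborel_integrable_affine[OF h, of 1 "- x"] by simp
  then have "integrable lborel (\<lambda>y. h (y - x) * exp (\<i> * of_real (y \<bullet> \<xi>)))"
    by (rule integrable_mult_continuous[where B=1]) (auto intro!: continuous_intros)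
  then show ?thesis
    unfolding tf_shift_def by (simp add: mult.commute)
qed

lemma norm_tf_shift: "norm (tf_shift (x, \<xi>) h y) = norm (h (y - x))"
  by (simp add: tf_shift_def norm_mult)

text \<open>The Fourier transform turns the translation by \<open>x\<close> into a modulation and the modulation by \<open>\<xi>\<close> into
  a translation. This is why decay on the Fourier side controls the frequency variable.\<close>

lemma fourier_tf_shift:
  fixes h :: "real^'d::finite \<Rightarrow> complex"
  assumes h: "integrable lborel h"
  shows "fourier (tf_shift (x, \<xi>) h) \<eta> = exp (- \<i> * of_real (x \<bullet> (\<eta> - \<xi>))) * fourier h (\<eta> - \<xi>)"
proof -
  have i: "integrable lborel (\<lambda>y. tf_shift (x, \<xi>) h y * exp (- \<i> * of_real (y \<bullet> \<eta>)))"
    by (rule integrable_mult_continuous[OF integrable_tf_shift[OF h], where B=1])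
       (auto intro!: continuous_intros simp: norm_exp_eq_Re)
  have "fourier (tf_shift (x, \<xi>) h) \<eta> =
      (LINT y|lborel. tf_shift (x, \<xi>) h (x + y) * exp (- \<i> * of_real ((x + y) \<bullet> \<eta>)))"
    unfolding fourier_def using lborel_integral_affine[OF i, of 1 x] by simp
  also have "\<dots> = (LINT y|lborel. exp (- \<i> * of_real (x \<bullet> (\<eta> - \<xi>))) * (h y * exp (- \<i> * of_real (y \<bullet> (\<eta> - \<xi>)))))"
  proof (intro Bochner_Integration.integral_cong refl)
    fix y
    have "exp (\<i> * of_real ((x + y) \<bullet> \<xi>)) * exp (- \<i> * of_real ((x + y) \<bullet> \<eta>)) =
        exp (- \<i> * of_real (x \<bullet> (\<eta> - \<xi>))) * exp (- \<i> * of_real (y \<bullet> (\<eta> - \<xi>)))"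
      by (simp add: exp_add[symmetric] inner_simps algebra_simps)
    then show "tf_shift (x, \<xi>) h (x + y) * exp (- \<i> * of_real ((x + y) \<bullet> \<eta>)) =
        exp (- \<i> * of_real (x \<bullet> (\<eta> - \<xi>))) * (h y * exp (- \<i> * of_real (y \<bullet> (\<eta> - \<xi>))))"
      by (simp add: tf_shift_def mult_ac)
  qed
  finally show ?thesis
    unfolding fourier_def by simp
qed

section \<open>Weight functions and exponential decay\<close>

lemma weight_functionD:
  assumes "weight_function \<omega>"
  shows weight_nonneg: "0 \<le> t \<Longrightarrow> 0 \<le> \<omega> t"
    and weight_mono: "0 \<le> s \<Longrightarrow> s \<le> t \<Longrightarrow> \<omega> s \<le> \<omega> t"
  using assms by (auto simp: weight_function_def mono_on_def)

text \<open>By monotonicity, \<open>\<omega>\<close> at \<open>r \<le> s + t\<close> is at most \<open>\<omega>\<close> at twice the larger of \<open>s\<close> and \<open>t\<close>; the doubling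
  condition \<open>(\<alpha>)\<close> does the rest. This replaces subadditivity.\<close>

lemma weight_quasi_subadditive:
  assumes w: "weight_function \<omega>"
  obtains L where "L \<ge> 1"
    "\<And>r s t. 0 \<le> r \<Longrightarrow> 0 \<le> s \<Longrightarrow> 0 \<le> t \<Longrightarrow> r \<le> s + t \<Longrightarrow> \<omega> r \<le> L * (\<omega> s + \<omega> t + 1)"
proof -
  obtain L where L: "L \<ge> 1" "\<And>t. t \<ge> 0 \<Longrightarrow> \<omega> (2 * t) \<le> L * (\<omega> t + 1)"
    using w unfolding weight_function_def by blast
  have "\<omega> r \<le> L * (\<omega> s + \<omega> t + 1)" if "0 \<le> r" "0 \<le> s" "0 \<le> t" "r \<le> s + t" for r s t
  proof -
    have "\<omega> r \<le> \<omega> (2 * max s t)"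
      using that by (intro weight_mono[OF w]) auto
    also have "\<dots> \<le> L * (\<omega> (max s t) + 1)"
      using that by (intro L) auto
    also have "\<dots> \<le> L * (\<omega> s + \<omega> t + 1)"
      using L(1) weight_nonneg[OF w that(2)] weight_nonneg[OF w that(3)]
      by (intro mult_left_mono) (auto simp: max_def)
    finally show ?thesis .
  qed
  with L(1) show ?thesis by (rule that)
qed

text \<open>A product of one-dimensional kernels whose integrability is elementary; it serves as a common
  integrable majorant in place of a power of \<open>1 + norm y\<close>.\<close>

definition cauchy_kernel :: "'a::euclidean_space \<Rightarrow> real" where
  "cauchy_kernel y = (\<Prod>b\<in>Basis. inverse (1 + (y \<bullet> b)\<^sup>2))"

lemma cauchy_kernel_nonneg: "0 \<le> cauchy_kernel y"
  by (auto simp: cauchy_kernel_def intro!: prod_nonneg)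

lemma integrable_cauchy_kernel: "integrable lborel cauchy_kernel"
proof -
  have "integrable lborel (\<lambda>x::real. inverse (1 + x\<^sup>2))"
    using integrable_inverse_1_plus_square by (simp add: set_integrable_def)
  then show ?thesis
    unfolding cauchy_kernel_def by (rule integrable_lborel_prod)
qed

lemma cauchy_kernel_lower_bound:
  fixes y :: "'a::euclidean_space"
  shows "inverse ((1 + norm y) ^ (2 * DIM('a))) \<le> cauchy_kernel y"
proof -
  have "(\<Prod>b\<in>(Basis::'a set). 1 + (y \<bullet> b)\<^sup>2) \<le> (\<Prod>b\<in>(Basis::'a set). (1 + norm y)\<^sup>2)"
  proof (intro prod_mono conjI)
    fix b :: 'a assume "b \<in> Basis"
    then have "(y \<bullet> b)\<^sup>2 \<le> (norm y)\<^sup>2"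
      using Basis_le_norm[of b y] by (metis abs_ge_zero power2_abs power_mono)
    then show "1 + (y \<bullet> b)\<^sup>2 \<le> (1 + norm y)\<^sup>2"
      by (simp add: power2_sum add_increasing2)
  qed simp
  also have "\<dots> = (1 + norm y) ^ (2 * DIM('a))"
    by (simp add: power_mult)
  finally have "inverse ((1 + norm y) ^ (2 * DIM('a))) \<le> inverse (\<Prod>b\<in>(Basis::'a set). 1 + (y \<bullet> b)\<^sup>2)"
    by (intro le_imp_inverse_le prod_pos) (auto intro: add_pos_nonneg)
  then show ?thesis
    unfolding cauchy_kernel_def
    using prod_inversef[of "\<lambda>b. 1 + (y \<bullet> b)\<^sup>2" Basis] by (simp only: comp_def)
qed

text \<open>Condition \<open>(\<gamma>)\<close> makes \<open>exp (- M * \<omega> (norm y))\<close> decay like a power of \<open>1 + norm y\<close>, and a power of order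
  twice the dimension lies below \<open>cauchy_kernel\<close>.\<close>

lemma weight_cauchy_kernel:
  assumes w: "weight_function \<omega>"
  obtains M C where "M > 0" "C > 0"
    "\<And>y::'a::euclidean_space. exp (- (M * \<omega> (norm y))) \<le> C * cauchy_kernel y"
proof -
  obtain a b where b: "b > 0" "\<And>t. t \<ge> 0 \<Longrightarrow> a + b * ln (1 + t) \<le> \<omega> t"
    using w unfolding weight_function_def by blast
  define n where "n = 2 * DIM('a)"
  \<comment> \<open>chosen so that the guaranteed decay has exponent exactly \<open>n\<close>\<close>
  define M where "M = real n / b"
  have M: "M > 0" "M * b = real n"
    using b(1) by (auto simp: M_def n_def)
  have "exp (- (M * \<omega> (norm y))) \<le> exp (- (M * a)) * cauchy_kernel y" for y :: 'a
  proof -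
    have "M * (a + b * ln (1 + norm y)) \<le> M * \<omega> (norm y)"
      using M by (intro mult_left_mono b) auto
    then have "exp (- (M * \<omega> (norm y))) \<le> exp (- (M * a) - M * b * ln (1 + norm y))"
      by (simp add: algebra_simps)
    also have "\<dots> = exp (- (M * a)) * inverse ((1 + norm y) ^ n)"
      unfolding M(2) by (simp add: exp_diff exp_of_nat_mult add_pos_nonneg divide_inverse)
    also have "\<dots> \<le> exp (- (M * a)) * cauchy_kernel y"
      unfolding n_def by (intro mult_left_mono cauchy_kernel_lower_bound) simp
    finally show ?thesis .
  qed
  with M(1) show ?thesis by (intro that[of M "exp (- (M * a))"]) auto
qed

text \<open>That \<open>P\<close> bounds the order-zero seminorm of \<open>g\<close>. An explicit bound is used rather than the supremum,
  whose value carries no information about unbounded functions.\<close>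

definition exp_decay :: "(real \<Rightarrow> real) \<Rightarrow> real \<Rightarrow> real \<Rightarrow> ('a::real_normed_vector \<Rightarrow> complex) \<Rightarrow> bool" where
  "exp_decay \<omega> r P g \<longleftrightarrow> (\<forall>x. exp (r * \<omega> (norm x)) * norm (g x) \<le> P)"

lemma exp_decayD: "exp_decay \<omega> r P g \<Longrightarrow> norm (g x) \<le> P * exp (- (r * \<omega> (norm x)))"
  by (simp add: exp_decay_def exp_minus field_simps)

lemma exp_decay_nonneg: "exp_decay \<omega> r P g \<Longrightarrow> 0 \<le> P"
  unfolding exp_decay_def by (meson exp_ge_zero mult_nonneg_nonneg norm_ge_zero order_trans)

lemma exp_decay_weaken:
  assumes "weight_function \<omega>" "exp_decay \<omega> r P g" "s \<le> r"
  shows "exp_decay \<omega> s P g"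
  unfolding exp_decay_def
proof
  fix x
  have "exp (s * \<omega> (norm x)) * norm (g x) \<le> exp (r * \<omega> (norm x)) * norm (g x)"
    using assms weight_nonneg[OF assms(1), of "norm x"] by (intro mult_right_mono) (auto intro: mult_right_mono)
  also have "\<dots> \<le> P" using assms(2) by (simp add: exp_decay_def)
  finally show "exp (s * \<omega> (norm x)) * norm (g x) \<le> P" .
qed

lemma exp_decay_bounded:
  assumes "weight_function \<omega>" "exp_decay \<omega> r P g" "0 \<le> r"
  shows "norm (g x) \<le> P"
  using exp_decay_weaken[OF assms] by (simp add: exp_decay_def)

lemma exp_decay_integrable:
  assumes w: "weight_function \<omega>"
  obtains M where "M > 0"
    "\<And>r P (g::'a::euclidean_space \<Rightarrow> complex). M \<le> r \<Longrightarrow> continuous_on UNIV g \<Longrightarrow> exp_decay \<omega> r P g \<Longrightarrow> integrable lborel g"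
proof -
  obtain M C where M: "M > 0" "C > 0"
    "\<And>y::'a. exp (- (M * \<omega> (norm y))) \<le> C * cauchy_kernel y"
    using weight_cauchy_kernel[OF w] by blast
  have "integrable lborel g" if r: "M \<le> r" and g: "continuous_on UNIV g" "exp_decay \<omega> r P g"
    for r P and g :: "'a \<Rightarrow> complex"
  proof (rule Bochner_Integration.integrable_bound)
    show "integrable lborel (\<lambda>y::'a. P * (C * cauchy_kernel y))"
      by (intro integrable_mult_right integrable_cauchy_kernel)
    show "g \<in> borel_measurable lborel"
      using borel_measurable_continuous_onI[OF g(1)] by simp
    have "norm (g y) \<le> P * (C * cauchy_kernel y)" for y
    proof -
      have "norm (g y) \<le> P * exp (- (M * \<omega> (norm y)))"
        by (intro exp_decayD exp_decay_weaken[OF w g(2) r])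
      also have "\<dots> \<le> P * (C * cauchy_kernel y)"
        using exp_decay_nonneg[OF g(2)] by (intro mult_left_mono M)
      finally show ?thesis .
    qed
    then show "AE y in lborel. norm (g y) \<le> norm (P * (C * cauchy_kernel y))"
      by (intro always_eventually allI) (metis abs_ge_self order_trans real_norm_def)
  qed
  with M(1) show ?thesis by (rule that)
qed

text \<open>Part of the decay of the two factors is spent, through quasi-subadditivity, on the weight at \<open>x\<close>:
  \<open>\<omega> (norm x)\<close> is controlled by \<open>\<omega> (norm y) + \<omega> (norm (y - x))\<close>. The remaining decay
  \<open>exp (- M * \<omega> (norm y))\<close> of \<open>g\<close> makes the integral converge. This one estimate is used both for
  functions and for their Fourier transforms.\<close>

lemma exp_decay_correlation:
  assumes w: "weight_function \<omega>" and k: "k \<ge> 0"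
  obtains r J where "r > 0" "J \<ge> 0"
    "\<And>P Q (g::'a::euclidean_space \<Rightarrow> complex) h x. continuous_on UNIV g \<Longrightarrow> continuous_on UNIV h \<Longrightarrow>
      exp_decay \<omega> r P g \<Longrightarrow> exp_decay \<omega> r Q h \<Longrightarrow>
      (LINT y|lborel. norm (g y) * norm (h (y - x))) * exp (k * \<omega> (norm x)) \<le> J * P * Q"
proof -
  obtain L where L: "L \<ge> 1"
    "\<And>r s t. 0 \<le> r \<Longrightarrow> 0 \<le> s \<Longrightarrow> 0 \<le> t \<Longrightarrow> r \<le> s + t \<Longrightarrow> \<omega> r \<le> L * (\<omega> s + \<omega> t + 1)"
    using weight_quasi_subadditive[OF w] by blast
  obtain M C where M: "M > 0" "C > 0"
    "\<And>y::'a. exp (- (M * \<omega> (norm y))) \<le> C * cauchy_kernel y"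
    using weight_cauchy_kernel[OF w] by blast
  define I where "I = (LINT y|lborel. cauchy_kernel (y::'a))"
  have I: "I \<ge> 0"
    unfolding I_def by (intro integral_nonneg_AE always_eventually allI cauchy_kernel_nonneg)
  \<comment> \<open>\<open>k * L\<close> pays for the weight at \<open>x\<close>, and \<open>M\<close> for convergence\<close>
  let ?r = "k * L + M"
  have r: "?r > 0" "k * L \<le> ?r" "0 \<le> k * L"
    using M k L by (auto intro: add_nonneg_pos)
  have "(LINT y|lborel. norm (g y) * norm (h (y - x))) * exp (k * \<omega> (norm x)) \<le> (exp (k * L) * C * I) * P * Q"
    if c: "continuous_on UNIV g" "continuous_on UNIV h" and g: "exp_decay \<omega> ?r P g" and h: "exp_decay \<omega> ?r Q h"
    for P Q and g h :: "'a \<Rightarrow> complex" and x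
  proof -
    have P: "0 \<le> P" and Q: "0 \<le> Q"
      using exp_decay_nonneg g h by blast+
    define K where "K = exp (k * L) * C * P * Q * exp (- (k * \<omega> (norm x)))"
    have b: "norm (g y) * norm (h (y - x)) \<le> K * cauchy_kernel y" for y
    proof -
      have "norm x \<le> norm y + norm (y - x)"
        using norm_triangle_ineq4[of y "y - x"] by simp
      then have "k * \<omega> (norm x) \<le> k * (L * (\<omega> (norm y) + \<omega> (norm (y - x)) + 1))"
        using k by (intro mult_left_mono L) auto
      then have e: "- (k * L * \<omega> (norm y)) + - (k * L * \<omega> (norm (y - x))) \<le> k * L + - (k * \<omega> (norm x))"
        by (simp add: algebra_simps)
      have "norm (g y) * norm (h (y - x)) \<le>
          (P * exp (- (?r * \<omega> (norm y)))) * (Q * exp (- (k * L * \<omega> (norm (y - x)))))"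
        using P by (intro mult_mono exp_decayD g exp_decay_weaken[OF w h]) (use M(1) in auto)
      also have "\<dots> = P * Q * exp (- (M * \<omega> (norm y))) *
          exp (- (k * L * \<omega> (norm y)) + - (k * L * \<omega> (norm (y - x))))"
        by (simp add: exp_add[symmetric] algebra_simps)
      also have "\<dots> \<le> P * Q * (C * cauchy_kernel y) * exp (k * L + - (k * \<omega> (norm x)))"
        using P Q M(2) e
        by (intro mult_mono mult_left_mono M) (auto intro!: mult_nonneg_nonneg cauchy_kernel_nonneg)
      also have "\<dots> = K * cauchy_kernel y"
        unfolding K_def exp_add by (simp only: mult_ac)
      finally show ?thesis .
    qed
    have ik: "integrable lborel (\<lambda>y::'a. K * cauchy_kernel y)"
      by (intro integrable_mult_right integrable_cauchy_kernel)
    have "integrable lborel (\<lambda>y. norm (g y) * norm (h (y - x)))"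
    proof (rule Bochner_Integration.integrable_bound[OF ik])
      have "continuous_on UNIV (\<lambda>y. norm (g y) * norm (h (y - x)))"
        by (intro continuous_intros c continuous_on_compose2[OF c(2)]) auto
      then show "(\<lambda>y. norm (g y) * norm (h (y - x))) \<in> borel_measurable lborel"
        using borel_measurable_continuous_onI by auto
      show "AE y in lborel. norm (norm (g y) * norm (h (y - x))) \<le> norm (K * cauchy_kernel y)"
        using order_trans[OF b abs_ge_self] by (simp add: abs_mult)
    qed
    then have "(LINT y|lborel. norm (g y) * norm (h (y - x))) \<le> (LINT y|lborel. K * cauchy_kernel (y::'a))"
      by (intro integral_mono ik b)
    also have "\<dots> = K * I"
      by (simp add: I_def)
    finally have "(LINT y|lborel. norm (g y) * norm (h (y - x))) * exp (k * \<omega> (norm x))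
        \<le> K * I * exp (k * \<omega> (norm x))"
      by (intro mult_right_mono) auto
    also have "\<dots> = (exp (k * L) * C * I) * P * Q * (exp (- (k * \<omega> (norm x))) * exp (k * \<omega> (norm x)))"
      by (simp add: K_def mult_ac)
    also have "exp (- (k * \<omega> (norm x))) * exp (k * \<omega> (norm x)) = 1"
      by (simp flip: exp_add)
    finally show ?thesis by simp
  qed
  then show ?thesis
    using r I M by (intro that[of ?r "exp (k * L) * C * I"]) (auto intro!: mult_nonneg_nonneg)
qed

section \<open>Decay of the short-time Fourier transform\<close>

text \<open>The only list of coordinate directions in which no direction occurs is the empty one.\<close>

lemma multi_partial_0: "multi_partial (\<lambda>_. 0) u = u"
proof -
  have "(SOME is. \<forall>i::'a. count_list is i = 0) = []"
  proof (rule some_equality)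
    fix "is" :: "'a list" assume "\<forall>i. count_list is i = 0"
    then have "count_list is (hd is) = 0" by simp
    then show "is = []" by (cases "is") auto
  qed simp
  then show ?thesis
    by (simp add: multi_partial_def iter_partial_def)
qed

lemma weighted_deriv_0: "weighted_deriv \<omega> r (\<lambda>_. 0) u x = exp (r * \<omega> (norm x)) * norm (u x)"
  by (simp add: weighted_deriv_def multi_partial_0)

lemma smooth_continuous: "smooth u \<Longrightarrow> continuous_on UNIV u"
  unfolding smooth_def by (drule spec[of _ "[]"]) (simp add: iter_partial_def)

lemma S_spaceD:
  assumes "u \<in> S_space \<omega>"
  shows S_space_integrable: "integrable lborel u"
    and S_space_continuous: "continuous_on UNIV u"
    and S_space_continuous_fourier: "continuous_on UNIV (fourier u)"
    and S_space_decay: "r > 0 \<Longrightarrow> \<exists>P. exp_decay \<omega> r P u"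
    and S_space_decay_fourier: "r > 0 \<Longrightarrow> \<exists>P. exp_decay \<omega> r P (fourier u)"
proof -
  show "integrable lborel u" "continuous_on UNIV u" "continuous_on UNIV (fourier u)"
    using assms smooth_continuous by (auto simp: S_space_def)
  have "bdd_above (range (weighted_deriv \<omega> r (\<lambda>_. 0) u))"
    "bdd_above (range (weighted_deriv \<omega> r (\<lambda>_. 0) (fourier u)))" if "r > 0"
    using assms that by (auto simp: S_space_def)
  then show "r > 0 \<Longrightarrow> \<exists>P. exp_decay \<omega> r P u" "r > 0 \<Longrightarrow> \<exists>P. exp_decay \<omega> r P (fourier u)"
    by (auto simp: bdd_above_def weighted_deriv_0 exp_decay_def)
qed

lemma integrable_bracket:
  fixes u \<phi> :: "real^'d::finite \<Rightarrow> complex"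
  assumes w: "weight_function \<omega>" and u: "u \<in> S_space \<omega>" and \<phi>: "integrable lborel \<phi>"
  shows "integrable lborel (\<lambda>y. u y * cnj (tf_shift \<sigma> \<phi> y))"
proof -
  obtain P where P: "exp_decay \<omega> 1 P u"
    using S_space_decay[OF u, of 1] by auto
  have "integrable lborel (\<lambda>y. cnj (tf_shift \<sigma> \<phi> y))"
    using integrable_tf_shift[OF \<phi>, of "fst \<sigma>" "snd \<sigma>"] by simp
  then have "integrable lborel (\<lambda>y. cnj (tf_shift \<sigma> \<phi> y) * u y)"
    by (rule integrable_mult_continuous[OF _ S_space_continuous[OF u] exp_decay_bounded[OF w P]]) simp
  then show ?thesis by (simp add: mult.commute)
qed

lemma norm_bracket_tf_shift_le:
  "norm (bracket u (tf_shift (x, \<xi>) \<phi>)) \<le> (LINT y|lborel. norm (u y) * norm (\<phi> (y - x)))"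
  unfolding bracket_def
  by (rule order_trans[OF integral_norm_bound]) (simp add: norm_mult norm_tf_shift)

text \<open>The counterpart of the preceding bound on the Fourier side, by Parseval; the constant
  \<open>(2 * pi) ^ (- d)\<close> is at most 1.\<close>

lemma norm_bracket_tf_shift_fourier_le:
  fixes u \<phi> :: "real^'d::finite \<Rightarrow> complex"
  assumes u: "integrable lborel u" "continuous_on UNIV u" "\<And>x. norm (u x) \<le> B"
    and F: "integrable lborel (fourier u)" and \<phi>: "integrable lborel \<phi>"
  shows "norm (bracket u (tf_shift (x, \<xi>) \<phi>)) \<le>
    (LINT \<eta>|lborel. norm (fourier u \<eta>) * norm (fourier \<phi> (\<eta> - \<xi>)))"
proof -
  let ?V = "bracket (fourier u) (fourier (tf_shift (x, \<xi>) \<phi>))"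
  have "norm (bracket u (tf_shift (x, \<xi>) \<phi>)) = 1 / (2 * pi) ^ CARD('d) * norm ?V"
    using parseval[OF u F integrable_tf_shift[OF \<phi>, of x \<xi>]]
    by (simp add: norm_mult norm_divide norm_power)
  also have "\<dots> \<le> 1 * norm ?V"
  proof (intro mult_right_mono)
    have "1 \<le> (2 * pi) ^ CARD('d)"
      using pi_ge_two by (intro one_le_power) auto
    then show "1 / (2 * pi) ^ CARD('d) \<le> 1" by simp
  qed simp
  also have "\<dots> \<le> (LINT \<eta>|lborel. norm (fourier u \<eta>) * norm (fourier \<phi> (\<eta> - \<xi>)))"
    unfolding bracket_def mult_1
    by (rule order_trans[OF integral_norm_bound])
       (simp add: norm_mult fourier_tf_shift[OF \<phi>] norm_exp_eq_Re)
  finally show ?thesis .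
qed

text \<open>The time bound decays in \<open>x\<close>, the frequency bound in \<open>\<xi>\<close>. As the weight at \<open>(x, \<xi>)\<close> is controlled by
  the larger of the weights at \<open>x\<close> and \<open>\<xi>\<close>, whichever bound belongs to the larger one suffices.
  The hypotheses on \<open>u\<close> concern only \<open>u\<close> and its Fourier transform, without derivatives, so that the
  lemma applies to a difference of two functions in \<open>\<S>\<^sub>\<omega>\<close> without showing that \<open>\<S>\<^sub>\<omega>\<close> is closed under
  differences.\<close>

lemma short_time_fourier_decay:
  fixes \<phi> :: "real^'d::finite \<Rightarrow> complex"
  assumes w: "weight_function \<omega>" and \<phi>: "\<phi> \<in> S_space \<omega>" and k: "k \<ge> 0"
  obtains r C where "r > 0" "C \<ge> 0"
    "\<And>u P Q \<sigma>. integrable lborel u \<Longrightarrow> continuous_on UNIV u \<Longrightarrow> continuous_on UNIV (fourier u) \<Longrightarrow>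
      exp_decay \<omega> r P u \<Longrightarrow> exp_decay \<omega> r Q (fourier u) \<Longrightarrow>
      norm (bracket u (tf_shift \<sigma> \<phi>)) * exp (k * \<omega> (norm \<sigma>)) \<le> C * (P + Q)"
proof -
  obtain L where L: "L \<ge> 1"
    "\<And>r s t. 0 \<le> r \<Longrightarrow> 0 \<le> s \<Longrightarrow> 0 \<le> t \<Longrightarrow> r \<le> s + t \<Longrightarrow> \<omega> r \<le> L * (\<omega> s + \<omega> t + 1)"
    using weight_quasi_subadditive[OF w] by blast
  \<comment> \<open>the 2 allows for replacing a sum of two weights by twice the larger one\<close>
  define k' where "k' = 2 * k * L"
  have k': "k' \<ge> 0"
    using k L by (simp add: k'_def)
  obtain M where M: "M > 0"
    "\<And>r P (g::real^'d \<Rightarrow> complex). M \<le> r \<Longrightarrow> continuous_on UNIV g \<Longrightarrow> exp_decay \<omega> r P g \<Longrightarrow> integrable lborel g"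
    using exp_decay_integrable[OF w] by blast
  obtain r1 J where J: "r1 > 0" "J \<ge> 0"
    "\<And>P Q (g::real^'d \<Rightarrow> complex) h x. continuous_on UNIV g \<Longrightarrow> continuous_on UNIV h \<Longrightarrow>
      exp_decay \<omega> r1 P g \<Longrightarrow> exp_decay \<omega> r1 Q h \<Longrightarrow>
      (LINT y|lborel. norm (g y) * norm (h (y - x))) * exp (k' * \<omega> (norm x)) \<le> J * P * Q"
    using exp_decay_correlation[OF w k'] by blast
  define r where "r = max r1 M"
  have r: "r > 0" "r1 \<le> r" "M \<le> r"
    using J by (auto simp: r_def)
  obtain A where A: "exp_decay \<omega> r1 A \<phi>"
    using S_space_decay[OF \<phi> J(1)] by blast
  obtain B where B: "exp_decay \<omega> r1 B (fourier \<phi>)"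
    using S_space_decay_fourier[OF \<phi> J(1)] by blast
  have AB: "A \<ge> 0" "B \<ge> 0"
    using exp_decay_nonneg A B by blast+
  have "norm (bracket u (tf_shift \<sigma> \<phi>)) * exp (k * \<omega> (norm \<sigma>)) \<le> (exp (k * L) * J * (A + B)) * (P + Q)"
    if u: "integrable lborel u" "continuous_on UNIV u" "continuous_on UNIV (fourier u)"
      and P: "exp_decay \<omega> r P u" and Q: "exp_decay \<omega> r Q (fourier u)" for u P Q \<sigma>
  proof -
    obtain x \<xi> where \<sigma>: "\<sigma> = (x, \<xi>)" by force
    let ?V = "norm (bracket u (tf_shift (x, \<xi>) \<phi>))"
    have PQ: "P \<ge> 0" "Q \<ge> 0"
      using exp_decay_nonneg P Q by blast+
    have F: "integrable lborel (fourier u)"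
      using M(2)[OF r(3) u(3) Q] .
    have "?V * exp (k' * \<omega> (norm x)) \<le>
        (LINT y|lborel. norm (u y) * norm (\<phi> (y - x))) * exp (k' * \<omega> (norm x))"
      by (intro mult_right_mono norm_bracket_tf_shift_le) simp
    also have "\<dots> \<le> J * P * A"
      by (intro J(3) u A S_space_continuous[OF \<phi>] exp_decay_weaken[OF w P r(2)])
    also have "\<dots> \<le> J * ((A + B) * (P + Q))"
      using J(2) AB PQ by (subst mult.assoc) (intro mult_left_mono, auto simp: algebra_simps)
    finally have time: "?V * exp (k' * \<omega> (norm x)) \<le> J * ((A + B) * (P + Q))" .
    have "?V * exp (k' * \<omega> (norm \<xi>)) \<le>
        (LINT \<eta>|lborel. norm (fourier u \<eta>) * norm (fourier \<phi> (\<eta> - \<xi>))) * exp (k' * \<omega> (norm \<xi>))"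
      by (intro mult_right_mono norm_bracket_tf_shift_fourier_le[OF u(1,2)
            exp_decay_bounded[OF w P less_imp_le[OF r(1)]] F S_space_integrable[OF \<phi>]]) simp
    also have "\<dots> \<le> J * Q * B"
      by (intro J(3) u B S_space_continuous_fourier[OF \<phi>] exp_decay_weaken[OF w Q r(2)])
    also have "\<dots> \<le> J * ((A + B) * (P + Q))"
      using J(2) AB PQ by (subst mult.assoc) (intro mult_left_mono, auto simp: algebra_simps)
    finally have freq: "?V * exp (k' * \<omega> (norm \<xi>)) \<le> J * ((A + B) * (P + Q))" .
    define m where "m = max (\<omega> (norm x)) (\<omega> (norm \<xi>))"
    have Vm: "?V * exp (k' * m) \<le> J * ((A + B) * (P + Q))"
      using time freq by (simp add: m_def max_def)
    have "\<omega> (norm \<sigma>) \<le> L * (\<omega> (norm x) + \<omega> (norm \<xi>) + 1)"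
      unfolding \<sigma> by (intro L norm_Pair_le) auto
    also have "\<dots> \<le> L * (2 * m + 1)"
      using L(1) by (intro mult_left_mono) (auto simp: m_def)
    finally have "k * \<omega> (norm \<sigma>) \<le> k * (L * (2 * m + 1))"
      using k by (rule mult_left_mono)
    then have "k * \<omega> (norm \<sigma>) \<le> k * L + k' * m"
      by (simp add: k'_def algebra_simps)
    then have "?V * exp (k * \<omega> (norm \<sigma>)) \<le> ?V * exp (k * L + k' * m)"
      by (intro mult_left_mono) auto
    also have "\<dots> = exp (k * L) * (?V * exp (k' * m))"
      by (simp add: exp_add)
    also have "\<dots> \<le> exp (k * L) * (J * ((A + B) * (P + Q)))"
      using Vm by (intro mult_left_mono) auto
    finally show ?thesis by (simp add: \<sigma> mult.assoc)
  qed
  then show ?thesis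
    using r(1) J(2) AB by (intro that[of r "exp (k * L) * J * (A + B)"]) auto
qed

section \<open>Continuity of the analysis operator\<close>

lemma fourier_diff:
  fixes f g :: "real^'d::finite \<Rightarrow> complex"
  assumes "integrable lborel f" "integrable lborel g"
  shows "fourier (\<lambda>x. f x - g x) = (\<lambda>\<xi>. fourier f \<xi> - fourier g \<xi>)"
proof
  fix \<xi> :: "real^'d"
  have "integrable lborel (\<lambda>x. h x * exp (- \<i> * of_real (x \<bullet> \<xi>)))" if "integrable lborel h"
    for h :: "real^'d \<Rightarrow> complex"
    by (rule integrable_mult_continuous[OF that, where B=1])
       (auto intro!: continuous_intros simp: norm_exp_eq_Re)
  from Bochner_Integration.integral_diff[OF this[OF assms(1)] this[OF assms(2)]]
  show "fourier (\<lambda>x. f x - g x) \<xi> = fourier f \<xi> - fourier g \<xi>"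
    by (simp add: fourier_def left_diff_distrib)
qed

lemma analysis_op_diff:
  fixes f g \<phi> :: "real^'d::finite \<Rightarrow> complex"
  assumes w: "weight_function \<omega>" and f: "f \<in> S_space \<omega>" and g: "g \<in> S_space \<omega>"
    and \<phi>: "integrable lborel \<phi>"
  shows "analysis_op \<Gamma> \<phi> f \<sigma> - analysis_op \<Gamma> \<phi> g \<sigma> = analysis_op \<Gamma> \<phi> (\<lambda>x. f x - g x) \<sigma>"
  using Bochner_Integration.integral_diff[OF integrable_bracket[OF w f \<phi>, of \<sigma>] integrable_bracket[OF w g \<phi>, of \<sigma>]]
  by (simp add: analysis_op_def bracket_def left_diff_distrib)

lemma exp_decay_diff:
  assumes "exp_decay \<omega> r P f" "exp_decay \<omega> r Q g"
  shows "exp_decay \<omega> r (P + Q) (\<lambda>x. f x - g x)"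
  unfolding exp_decay_def
proof
  fix x
  have "exp (r * \<omega> (norm x)) * norm (f x - g x) \<le> exp (r * \<omega> (norm x)) * (norm (f x) + norm (g x))"
    by (intro mult_left_mono norm_triangle_ineq4) simp
  also have "\<dots> \<le> P + Q"
    using assms by (auto simp: exp_decay_def distrib_left intro: add_mono)
  finally show "exp (r * \<omega> (norm x)) * norm (f x - g x) \<le> P + Q" .
qed

lemma exp_decay_SUP:
  assumes "exp_decay \<omega> r P u"
  shows "exp_decay \<omega> r (SUP x. weighted_deriv \<omega> r (\<lambda>_. 0) u x) u"
  unfolding exp_decay_def
proof
  fix x
  have "bdd_above (range (weighted_deriv \<omega> r (\<lambda>_. 0) u))"
    using assms by (auto simp: bdd_above_def weighted_deriv_0 exp_decay_def)
  from cSUP_upper[OF UNIV_I this, of x]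
  show "exp (r * \<omega> (norm x)) * norm (u x) \<le> (SUP x. weighted_deriv \<omega> r (\<lambda>_. 0) u x)"
    by (simp add: weighted_deriv_0)
qed

text \<open>Membership in \<open>seq_space\<close> ensures that every supremum involved is that of a bounded set.\<close>

lemma seq_norm_triangle:
  assumes c: "c \<in> seq_space \<omega> \<Gamma>" and c': "c' \<in> seq_space \<omega> \<Gamma>" and h: "h \<in> seq_space \<omega> \<Gamma>"
    and ne: "\<Gamma> \<noteq> {}"
  shows "seq_norm \<omega> \<Gamma> k (\<lambda>\<sigma>. c \<sigma> - h \<sigma>) \<le>
    seq_norm \<omega> \<Gamma> k (\<lambda>\<sigma>. c \<sigma> - c' \<sigma>) + seq_norm \<omega> \<Gamma> k (\<lambda>\<sigma>. c' \<sigma> - h \<sigma>)"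
proof -
  let ?e = "\<lambda>\<sigma>. exp (real k * \<omega> (norm \<sigma>))"
  have bdd: "bdd_above ((\<lambda>\<sigma>. norm (a \<sigma> - b \<sigma>) * ?e \<sigma>) ` \<Gamma>)"
    if ab: "a \<in> seq_space \<omega> \<Gamma>" "b \<in> seq_space \<omega> \<Gamma>" for a b
  proof -
    obtain A B where A: "\<And>\<sigma>. \<sigma> \<in> \<Gamma> \<Longrightarrow> norm (a \<sigma>) * ?e \<sigma> \<le> A"
      and B: "\<And>\<sigma>. \<sigma> \<in> \<Gamma> \<Longrightarrow> norm (b \<sigma>) * ?e \<sigma> \<le> B"
      using ab by (auto simp: seq_space_def bdd_above_def) metis
    have "norm (a \<sigma> - b \<sigma>) * ?e \<sigma> \<le> A + B" if "\<sigma> \<in> \<Gamma>" for \<sigma>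
    proof -
      have "norm (a \<sigma> - b \<sigma>) * ?e \<sigma> \<le> (norm (a \<sigma>) + norm (b \<sigma>)) * ?e \<sigma>"
        by (intro mult_right_mono norm_triangle_ineq4) simp
      also have "\<dots> \<le> A + B"
        using A[OF that] B[OF that] by (simp add: distrib_right)
      finally show ?thesis .
    qed
    then show ?thesis by (auto simp: bdd_above_def)
  qed
  show ?thesis
    unfolding seq_norm_def
  proof (rule cSUP_least[OF ne])
    fix \<sigma> assume \<sigma>: "\<sigma> \<in> \<Gamma>"
    have "norm (c \<sigma> - h \<sigma>) * ?e \<sigma> \<le> (norm (c \<sigma> - c' \<sigma>) + norm (c' \<sigma> - h \<sigma>)) * ?e \<sigma>"
      by (intro mult_right_mono norm_diff_triangle_le[OF order_refl order_refl]) simp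
    also have "\<dots> \<le> (SUP \<sigma>\<in>\<Gamma>. norm (c \<sigma> - c' \<sigma>) * ?e \<sigma>) + (SUP \<sigma>\<in>\<Gamma>. norm (c' \<sigma> - h \<sigma>) * ?e \<sigma>)"
      unfolding distrib_right
      by (intro add_mono cSUP_upper[OF \<sigma>] bdd c c' h)
    finally show "norm (c \<sigma> - h \<sigma>) * ?e \<sigma> \<le>
        (SUP \<sigma>\<in>\<Gamma>. norm (c \<sigma> - c' \<sigma>) * ?e \<sigma>) + (SUP \<sigma>\<in>\<Gamma>. norm (c' \<sigma> - h \<sigma>) * ?e \<sigma>)" .
  qed
qed

text \<open>An additive operator is continuous as soon as each target seminorm is dominated by finitely many
  source seminorms; two suffice here. The subbasic semiballs of the target are centred at arbitrary
  \<open>h\<close>, possibly outside the range of \<open>A\<close>, so the triangle inequality is used to fit a neighbourhood of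
  \<open>f\<close> into the preimage. Additivity enters through the bound on \<open>A g - A f\<close> by seminorms of
  \<open>g - f\<close>.\<close>

lemma continuous_map_seminorm_topology:
  assumes maps: "\<And>f. f \<in> V \<Longrightarrow> A f \<in> W"
    and ne: "Q \<noteq> {}"
    and triangle: "\<And>q c c' h. q \<in> Q \<Longrightarrow> c \<in> W \<Longrightarrow> c' \<in> W \<Longrightarrow> h \<in> W \<Longrightarrow>
      q (\<lambda>x. c x - h x) \<le> q (\<lambda>x. c x - c' x) + q (\<lambda>x. c' x - h x)"
    and bound: "\<And>q. q \<in> Q \<Longrightarrow> \<exists>p1\<in>P. \<exists>p2\<in>P. \<exists>C\<ge>0. p1 (\<lambda>_. 0) = 0 \<and> p2 (\<lambda>_. 0) = 0 \<and>
      (\<forall>f\<in>V. \<forall>g\<in>V. q (\<lambda>x. A g x - A f x) \<le> C * (p1 (\<lambda>x. g x - f x) + p2 (\<lambda>x. g x - f x)))"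
  shows "continuous_map (seminorm_topology V P) (seminorm_topology W Q) A"
proof (cases "P = {}")
  case True
  then show ?thesis
    using ne bound by blast
next
  case False
  then have top: "topspace (seminorm_topology V P) = V"
    using topspace_seminorm_topology by blast
  have topW: "topspace (seminorm_topology W Q) = W"
    using ne topspace_seminorm_topology by blast
  have sub: "openin (seminorm_topology V P) {g \<in> V. p (\<lambda>x. g x - f x) < \<epsilon>}"
    if "f \<in> V" "p \<in> P" "0 < \<epsilon>" for f p and \<epsilon> :: real
    unfolding seminorm_topology_def using that by (intro topology_generated_by_Basis) blast
  show ?thesis
    unfolding seminorm_topology_def[of W Q]
  proof (rule continuous_on_generated_topo)
    show "A ` topspace (seminorm_topology V P) \<subseteq>
        \<Union> {{g \<in> W. q (\<lambda>x. g x - f x) < \<epsilon>} | f q \<epsilon>. f \<in> W \<and> q \<in> Q \<and> 0 < \<epsilon>}"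
      using maps unfolding top topW[unfolded seminorm_topology_def topology_generated_by_topspace] by blast
    fix U assume "U \<in> {{g \<in> W. q (\<lambda>x. g x - f x) < \<epsilon>} | f q \<epsilon>. f \<in> W \<and> q \<in> Q \<and> 0 < \<epsilon>}"
    then obtain h q \<epsilon> where U: "U = {c \<in> W. q (\<lambda>x. c x - h x) < \<epsilon>}" and h: "h \<in> W" and q: "q \<in> Q"
      by blast
    obtain p1 p2 C where p: "p1 \<in> P" "p2 \<in> P" "C \<ge> 0" "p1 (\<lambda>_. 0) = 0" "p2 (\<lambda>_. 0) = 0"
      "\<And>f g. f \<in> V \<Longrightarrow> g \<in> V \<Longrightarrow>
        q (\<lambda>x. A g x - A f x) \<le> C * (p1 (\<lambda>x. g x - f x) + p2 (\<lambda>x. g x - f x))"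
      using bound[OF q] by blast
    show "openin (seminorm_topology V P) (A -` U \<inter> topspace (seminorm_topology V P))"
    proof (subst openin_subopen, intro ballI)
      fix f assume "f \<in> A -` U \<inter> topspace (seminorm_topology V P)"
      then have f: "f \<in> V" "q (\<lambda>x. A f x - h x) < \<epsilon>"
        by (auto simp: top U)
      \<comment> \<open>\<open>\<delta>\<close> is the room left in the semiball at \<open>A f\<close>; the 1 in \<open>2 * C + 1\<close> covers \<open>C = 0\<close>\<close>
      define \<delta> where "\<delta> = \<epsilon> - q (\<lambda>x. A f x - h x)"
      define \<eta> where "\<eta> = \<delta> / (2 * C + 1)"
      have \<delta>: "\<delta> > 0" and \<eta>: "\<eta> > 0" "C * (2 * \<eta>) < \<delta>"
        using f(2) p(3) by (auto simp: \<delta>_def \<eta>_def field_simps)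
      let ?N = "{g \<in> V. p1 (\<lambda>x. g x - f x) < \<eta>} \<inter> {g \<in> V. p2 (\<lambda>x. g x - f x) < \<eta>}"
      have "openin (seminorm_topology V P) ?N"
        using f(1) p \<eta> by (intro openin_Int sub)
      moreover have "f \<in> ?N"
        using f(1) p \<eta> by simp
      moreover have "?N \<subseteq> A -` U \<inter> topspace (seminorm_topology V P)"
      proof
        fix g assume g: "g \<in> ?N"
        then have gV: "g \<in> V" by simp
        have "q (\<lambda>x. A g x - h x) \<le> q (\<lambda>x. A g x - A f x) + q (\<lambda>x. A f x - h x)"
          by (intro triangle q maps h gV f)
        also have "q (\<lambda>x. A g x - A f x) \<le> C * (p1 (\<lambda>x. g x - f x) + p2 (\<lambda>x. g x - f x))"
          by (intro p f gV)
        also have "\<dots> \<le> C * (2 * \<eta>)"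
          using g p(3) by (intro mult_left_mono) auto
        finally have "q (\<lambda>x. A g x - h x) < \<epsilon>"
          using \<eta>(2) by (simp add: \<delta>_def)
        then show "g \<in> A -` U \<inter> topspace (seminorm_topology V P)"
          using gV maps by (simp add: top U)
      qed
      ultimately show "\<exists>T. openin (seminorm_topology V P) T \<and> f \<in> T \<and>
          T \<subseteq> A -` U \<inter> topspace (seminorm_topology V P)"
        by blast
    qed
  qed
qed

lemma lattice_nonempty: "lattice a b \<noteq> {}"
proof -
  have "(0, 0) \<in> lattice a b"
    unfolding lattice_def by (auto intro!: exI[of _ 0])
  then show ?thesis by blast
qed

lemma analysis_op_seq_space:
  fixes f \<phi> :: "real^'d::finite \<Rightarrow> complex"
  assumes w: "weight_function \<omega>" and \<phi>: "\<phi> \<in> S_space \<omega>" and f: "f \<in> S_space \<omega>"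
  shows "analysis_op \<Gamma> \<phi> f \<in> seq_space \<omega> \<Gamma>"
proof -
  have "bdd_above ((\<lambda>\<sigma>. norm (analysis_op \<Gamma> \<phi> f \<sigma>) * exp (real k * \<omega> (norm \<sigma>))) ` \<Gamma>)" for k :: nat
  proof -
    obtain r C where "r > 0" and C:
      "\<And>u P Q \<sigma>. integrable lborel u \<Longrightarrow> continuous_on UNIV u \<Longrightarrow> continuous_on UNIV (fourier u) \<Longrightarrow>
        exp_decay \<omega> r P u \<Longrightarrow> exp_decay \<omega> r Q (fourier u) \<Longrightarrow>
        norm (bracket u (tf_shift \<sigma> \<phi>)) * exp (real k * \<omega> (norm \<sigma>)) \<le> C * (P + Q)"
      using short_time_fourier_decay[OF w \<phi>, of "real k"] by (metis of_nat_0_le_iff)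
    obtain P Q where "exp_decay \<omega> r P f" "exp_decay \<omega> r Q (fourier f)"
      using S_space_decay[OF f \<open>r > 0\<close>] S_space_decay_fourier[OF f \<open>r > 0\<close>] by blast
    then have "norm (bracket f (tf_shift \<sigma> \<phi>)) * exp (real k * \<omega> (norm \<sigma>)) \<le> C * (P + Q)" for \<sigma>
      by (intro C S_space_integrable[OF f] S_space_continuous[OF f] S_space_continuous_fourier[OF f])
    then show ?thesis
      unfolding bdd_above_def analysis_op_def by (intro exI[of _ "C * (P + Q)"]) auto
  qed
  then show ?thesis
    by (simp add: seq_space_def analysis_op_def)
qed

lemma analysis_op_continuous:
  fixes \<phi> :: "real^'d::finite \<Rightarrow> complex"
  assumes w: "weight_function \<omega>" and \<phi>: "\<phi> \<in> S_space \<omega>" and ne: "\<Gamma> \<noteq> {}"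
  shows "continuous_map (S_topology \<omega>) (seq_topology \<omega> \<Gamma>) (analysis_op \<Gamma> \<phi>)"
  unfolding S_topology_def seq_topology_def
proof (rule continuous_map_seminorm_topology)
  fix q assume "q \<in> range (seq_norm \<omega> \<Gamma>)"
  then obtain k where q: "q = seq_norm \<omega> \<Gamma> k" by blast
  obtain r C where r: "r > 0" and C0: "C \<ge> 0" and C:
    "\<And>u P Q \<sigma>. integrable lborel u \<Longrightarrow> continuous_on UNIV u \<Longrightarrow> continuous_on UNIV (fourier u) \<Longrightarrow>
      exp_decay \<omega> r P u \<Longrightarrow> exp_decay \<omega> r Q (fourier u) \<Longrightarrow>
      norm (bracket u (tf_shift \<sigma> \<phi>)) * exp (real k * \<omega> (norm \<sigma>)) \<le> C * (P + Q)"
    using short_time_fourier_decay[OF w \<phi>, of "real k"] by (metis of_nat_0_le_iff)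
  define p1 where "p1 = (\<lambda>u. SUP x. weighted_deriv \<omega> r (\<lambda>_::'d. 0) u x)"
  define p2 where "p2 = (\<lambda>u. SUP \<xi>. weighted_deriv \<omega> r (\<lambda>_::'d. 0) (fourier u) \<xi>)"
  have "p1 \<in> S_seminorms \<omega>" "p2 \<in> S_seminorms \<omega>"
    using r unfolding p1_def p2_def S_seminorms_def by blast+
  moreover have "p1 (\<lambda>_. 0) = 0" "p2 (\<lambda>_. 0) = 0"
    by (simp_all add: p1_def p2_def weighted_deriv_0 fourier_def)
  moreover have "q (\<lambda>\<sigma>. analysis_op \<Gamma> \<phi> g \<sigma> - analysis_op \<Gamma> \<phi> f \<sigma>) \<le>
      C * (p1 (\<lambda>x. g x - f x) + p2 (\<lambda>x. g x - f x))"
    if f: "f \<in> S_space \<omega>" and g: "g \<in> S_space \<omega>" for f g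
  proof -
    let ?u = "\<lambda>x. g x - f x"
    have F: "fourier ?u = (\<lambda>\<xi>. fourier g \<xi> - fourier f \<xi>)"
      by (intro fourier_diff S_space_integrable[OF f] S_space_integrable[OF g])
    obtain P P' where "exp_decay \<omega> r P f" "exp_decay \<omega> r P' g"
      using S_space_decay[OF f r] S_space_decay[OF g r] by blast
    then have 1: "exp_decay \<omega> r (p1 ?u) ?u"
      unfolding p1_def by (intro exp_decay_SUP[OF exp_decay_diff])
    obtain Q Q' where "exp_decay \<omega> r Q (fourier f)" "exp_decay \<omega> r Q' (fourier g)"
      using S_space_decay_fourier[OF f r] S_space_decay_fourier[OF g r] by blast
    then have 2: "exp_decay \<omega> r (p2 ?u) (fourier ?u)"
      unfolding p2_def F by (intro exp_decay_SUP[OF exp_decay_diff])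
    have "norm (bracket ?u (tf_shift \<sigma> \<phi>)) * exp (real k * \<omega> (norm \<sigma>)) \<le> C * (p1 ?u + p2 ?u)" for \<sigma>
    proof (rule C[OF _ _ _ 1 2])
      show "integrable lborel ?u"
        by (intro Bochner_Integration.integrable_diff S_space_integrable[OF f] S_space_integrable[OF g])
      show "continuous_on UNIV ?u"
        by (intro continuous_on_diff S_space_continuous[OF f] S_space_continuous[OF g])
      show "continuous_on UNIV (fourier ?u)"
        unfolding F
        by (intro continuous_on_diff S_space_continuous_fourier[OF f] S_space_continuous_fourier[OF g])
    qed
    then show ?thesis
      unfolding q seq_norm_def analysis_op_diff[OF w g f S_space_integrable[OF \<phi>]]
      by (intro cSUP_least[OF ne]) (simp add: analysis_op_def)
  qed
  ultimately show "\<exists>p1\<in>S_seminorms \<omega>. \<exists>p2\<in>S_seminorms \<omega>. \<exists>C\<ge>0. p1 (\<lambda>_. 0) = 0 \<and> p2 (\<lambda>_. 0) = 0 \<and>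
      (\<forall>f\<in>S_space \<omega>. \<forall>g\<in>S_space \<omega>. q (\<lambda>\<sigma>. analysis_op \<Gamma> \<phi> g \<sigma> - analysis_op \<Gamma> \<phi> f \<sigma>) \<le>
        C * (p1 (\<lambda>x. g x - f x) + p2 (\<lambda>x. g x - f x)))"
    using C0 by blast
qed (auto intro!: seq_norm_triangle[OF _ _ _ ne] analysis_op_seq_space[OF w \<phi>])

theorem proposition2p9:
  fixes \<omega> :: "real \<Rightarrow> real"
    and \<phi> :: "real^'d::finite \<Rightarrow> complex"
    and \<alpha>0 \<beta>0 :: real
    and \<Lambda> :: "((real^'d) \<times> (real^'d)) set"
  assumes "\<alpha>0 > 0" and "\<beta>0 > 0"
    and "\<Lambda> = lattice \<alpha>0 \<beta>0"
    and "gabor_frame (gaussian :: real^'d \<Rightarrow> complex) \<Lambda>"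
    and "weight_function \<omega>"
    and "\<phi> \<in> S_space \<omega> - {\<lambda>x. 0}"
  shows "(\<forall>f \<in> S_space \<omega>. \<forall>\<sigma> \<in> \<Lambda>. integrable lborel (\<lambda>y. f y * cnj (tf_shift \<sigma> \<phi> y))) \<and>
         (\<forall>f \<in> S_space \<omega>. analysis_op \<Lambda> \<phi> f \<in> seq_space \<omega> \<Lambda>) \<and>
         continuous_map (S_topology \<omega>) (seq_topology \<omega> \<Lambda>) (analysis_op \<Lambda> \<phi>)"
proof -
  have \<phi>: "\<phi> \<in> S_space \<omega>"
    using assms(6) by simp
  have "\<Lambda> \<noteq> {}"
    using lattice_nonempty assms(3) by blast
  then show ?thesis
    using integrable_bracket[OF assms(5) _ S_space_integrable[OF \<phi>]]
      analysis_op_seq_space[OF assms(5) \<phi>] analysis_op_continuous[OF assms(5) \<phi>]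
    by blast
qed

end
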